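(* For every composition $\alpha$, \[{\mathfrak S}^*_\alpha=\sum_{\beta\le_{\mathrm{lex}}\alpha}K_{\alpha,\beta}\,M_\beta,\] the sum over compositions $\beta$ of $|\alpha|$ lexicographically at most $\alpha$, where $K_{\alpha,\beta}$ is the number of immaculate tableaux of shape $\alpha$ and content $\beta$. In particular ${\mathfrak S}^*_\alpha$ is monomial positive.
   Context: Work over $\mathbb{Q}$. A composition $\alpha=[\alpha_1,\dots,\alpha_m]$ of $n$ is a sequence of positive integers summing to $n$. $\mathsf{NSym}$ is the free associative $\mathbb{Q}$-algebra on $H_1,H_2,\dots$ ($\deg H_i=i$), with degree-$n$ part $\mathsf{NSym}_n$; $H_{(a_1,\dots,a_m)}=H_{a_1}\cdots H_{a_m}$, $H_0=1$, $H_{-r}=0$. $\mathsf{QSym}$ is the algebra of quasi-symmetric functions with monomial basis $M_\alpha=\sum_{i_1<\dots<i_m}x_{i_1}^{\alpha_1}\cdots x_{i_m}^{\alpha_m}$, degree-$n$ part $\mathsf{QSym}_n$, paired with $\mathsf{NSym}$ by $\langle H_\alpha,M_\beta\rangle=\delta_{\alpha,\beta}$; $F^\perp$ is defined by $\langle F^\perp H,G\rangle=\langle H,FG\rangle$. With $D(\alpha)=\{\alpha_1,\dots,\alpha_1+\dots+\alpha_{m-1}\}$ and $\alpha\le\beta$ iff $D(\beta)\subseteq D(\alpha)$, $F_\alpha=\sum_{\beta\le\alpha}M_\beta$, $F_{1^i}=F_{(1,\dots,1)}$ ($i$ ones, $F_{1^0}=1$). $\mathbb{B}_m=\sum_{i\ge0}(-1)^iH_{m+i}F_{1^i}^\perp$;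 ${\mathfrak S}_\alpha=\mathbb{B}_{\alpha_1}\cdots\mathbb{B}_{\alpha_m}(1)$; the ${\mathfrak S}_\alpha$ ($\alpha$ a composition of $n$) form a basis of $\mathsf{NSym}_n$, and the dual immaculate functions ${\mathfrak S}^*_\beta\in\mathsf{QSym}_n$ are the dual basis: $\langle{\mathfrak S}_\alpha,{\mathfrak S}^*_\beta\rangle=\delta_{\alpha,\beta}$. An immaculate tableau of shape $\alpha$ and content $\beta$ is a filling of the diagram of $\alpha$ (row $j$ has $\alpha_j$ left-justified boxes, rows numbered from the top) with positive integers such that exactly $\beta_i$ boxes contain $i$, rows weakly increase left to right, and the first column strictly increases top to bottom (no condition on other columns). *)

theory Defs
  imports Complex_Main "HOL-Library.Poly_Mapping" "HOL-Library.List_Lexorder"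
begin

section \<open>Compositions\<close>

typedef comp = "{xs :: nat list. 0 \<notin> set xs}" morphisms parts Comp
  by (rule exI [of _ "[]"]) simp

setup_lifting type_definition_comp

text \<open>Addition is concatenation: compositions form the free monoid on the positive integers.\<close>

instantiation comp :: monoid_add
begin

lift_definition zero_comp :: comp is "[]" by simp

lift_definition plus_comp :: "comp \<Rightarrow> comp \<Rightarrow> comp" is "(@)" by simp

instance by standard (transfer, simp)+

end

definition weight :: "comp \<Rightarrow> nat" where
  "weight \<alpha> = sum_list (parts \<alpha>)"

definition partial_sums :: "comp \<Rightarrow> nat set" where
  "partial_sums \<alpha> = {sum_list (take k (parts \<alpha>)) |k. 1 \<le> k \<and> k < length (parts \<alpha>)}"

definition refines :: "comp \<Rightarrow> comp \<Rightarrow> bool" where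
  "refines \<alpha> \<beta> \<longleftrightarrow> weight \<alpha> = weight \<beta> \<and> partial_sums \<beta> \<subseteq> partial_sums \<alpha>"

lift_definition ones :: "nat \<Rightarrow> comp" is "\<lambda>i. replicate i 1" by simp

section \<open>Noncommutative symmetric functions\<close>

text \<open>The free associative algebra on \<open>H\<^sub>1, H\<^sub>2, \<dots>\<close> is the monoid algebra of the free monoid of
  compositions; the basis element of \<open>\<alpha>\<close> is the word \<open>H\<^sub>\<alpha>\<close>.\<close>

type_synonym nsym = "comp \<Rightarrow>\<^sub>0 rat"

definition HH :: "comp \<Rightarrow> nsym" where
  "HH \<alpha> = Poly_Mapping.single \<alpha> 1"

definition H :: "int \<Rightarrow> nsym" where
  "H r = (if r < 0 then 0 else if r = 0 then 1 else HH (Comp [nat r]))"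

section \<open>Quasi-symmetric functions\<close>

text \<open>Formal power series in countably many commuting variables (indexed from 0), given by their
  coefficients.\<close>

type_synonym monomial = "nat \<Rightarrow>\<^sub>0 nat"
type_synonym series = "monomial \<Rightarrow> rat"

definition mdeg :: "monomial \<Rightarrow> nat" where
  "mdeg m = (\<Sum>i\<in>Poly_Mapping.keys m. Poly_Mapping.lookup m i)"

definition series_mult :: "series \<Rightarrow> series \<Rightarrow> series" (infixl \<open>\<star>\<close> 70) where
  "f \<star> g = (\<lambda>m. \<Sum>(p, q) | p + q = m. f p * g q)"

definition mono_word :: "nat list \<Rightarrow> nat list \<Rightarrow> monomial" where
  "mono_word is as = sum_list (map2 Poly_Mapping.single is as)"

definition QSym :: "series set" where
  "QSym = {f. (\<exists>d. \<forall>m. f m \<noteq> 0 \<longrightarrow> mdeg m \<le> d) \<and>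
     (\<forall>\<alpha> is js. sorted_wrt (<) is \<and> sorted_wrt (<) js \<and>
        length is = length (parts \<alpha>) \<and> length js = length (parts \<alpha>) \<longrightarrow>
        f (mono_word is (parts \<alpha>)) = f (mono_word js (parts \<alpha>)))}"

definition QSym_deg :: "nat \<Rightarrow> series set" where
  "QSym_deg n = {f \<in> QSym. \<forall>m. f m \<noteq> 0 \<longrightarrow> mdeg m = n}"

text \<open>The coefficient of \<open>m\<close> in \<open>\<Sum> x\<^bsub>i\<^sub>1\<^esub>\<^bsup>\<alpha>\<^sub>1\<^esup> \<cdots> x\<^bsub>i\<^sub>m\<^esub>\<^bsup>\<alpha>\<^sub>m\<^esup>\<close> counts the index sequences producing \<open>m\<close>.\<close>

definition M :: "comp \<Rightarrow> series" where
  "M \<alpha> = (\<lambda>m. of_nat (card {is. sorted_wrt (<) is \<and> length is = length (parts \<alpha>) \<and>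
     mono_word is (parts \<alpha>) = m}))"

definition F :: "comp \<Rightarrow> series" where
  "F \<alpha> = (\<lambda>m. \<Sum>\<beta> | refines \<beta> \<alpha>. M \<beta> m)"

text \<open>The coefficient of \<open>M\<^sub>\<alpha>\<close> in the monomial expansion of a quasi-symmetric function \<open>f\<close> is the
  coefficient in \<open>f\<close> of the monomial with exponents \<open>\<alpha>\<^sub>1, \<alpha>\<^sub>2, \<dots>\<close> on the first variables;
  see \<open>QSym_expansion\<close> and \<open>M_coeff_M\<close> below.\<close>

definition M_coeff :: "series \<Rightarrow> comp \<Rightarrow> rat" where
  "M_coeff f \<alpha> = f (mono_word [0..<length (parts \<alpha>)] (parts \<alpha>))"

definition monomial_positive :: "series \<Rightarrow> bool" where
  "monomial_positive f \<longleftrightarrow> f \<in> QSym \<and> (\<forall>\<beta>. M_coeff f \<beta> \<ge> 0)"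

section \<open>Duality\<close>

text \<open>The bilinear pairing with \<open>\<langle>H\<^sub>\<alpha>, M\<^sub>\<beta>\<rangle> = \<delta>\<close>; see \<open>pairing_HH_M\<close> below.\<close>

definition pairing :: "nsym \<Rightarrow> series \<Rightarrow> rat" where
  "pairing h f = (\<Sum>\<alpha>\<in>Poly_Mapping.keys h. Poly_Mapping.lookup h \<alpha> * M_coeff f \<alpha>)"

text \<open>Existence and uniqueness are proved below (\<open>pairing_perp\<close>, \<open>perp_eqI\<close>).\<close>

definition perp :: "series \<Rightarrow> nsym \<Rightarrow> nsym" where
  "perp f h = (THE h'. \<forall>g\<in>QSym. pairing h' g = pairing h (f \<star> g))"

section \<open>Immaculate and dual immaculate functions\<close>

text \<open>Only finitely many terms of the sum are nonzero; see \<open>finite_BB_support\<close> below.\<close>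

definition BB :: "int \<Rightarrow> nsym \<Rightarrow> nsym" where
  "BB m h = Sum_any (\<lambda>i. (-1) ^ i * H (m + int i) * perp (F (ones i)) h)"

definition immaculate :: "comp \<Rightarrow> nsym" where
  "immaculate \<alpha> = foldr (\<lambda>a. BB (int a)) (parts \<alpha>) 1"

definition dual_immaculate :: "comp \<Rightarrow> series" where
  "dual_immaculate \<beta> = (THE f. f \<in> QSym_deg (weight \<beta>) \<and>
     (\<forall>\<alpha>. weight \<alpha> = weight \<beta> \<longrightarrow> pairing (immaculate \<alpha>) f = (if \<alpha> = \<beta> then 1 else 0)))"

text \<open>A filling is the list of its rows, from top to bottom.\<close>

definition immaculate_tableau :: "comp \<Rightarrow> comp \<Rightarrow> nat list list \<Rightarrow> bool" where
  "immaculate_tableau \<alpha> \<beta> T \<longleftrightarrow>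
     map length T = parts \<alpha> \<and>
     0 \<notin> set (concat T) \<and>
     (\<forall>i\<ge>1. count_list (concat T) i =
        (if i \<le> length (parts \<beta>) then parts \<beta> ! (i - 1) else 0)) \<and>
     (\<forall>row\<in>set T. sorted row) \<and>
     sorted_wrt (<) (map hd T)"

definition K :: "comp \<Rightarrow> comp \<Rightarrow> nat" where
  "K \<alpha> \<beta> = card {T. immaculate_tableau \<alpha> \<beta> T}"

section \<open>Well-definedness\<close>

lemma zero_notin_parts [simp]: "0 \<notin> set (parts \<alpha>)"
  using parts [of \<alpha>] by simp

lemma finite_weight_le: "finite {\<alpha>. weight \<alpha> \<le> n}"
proof -
  have len: "length xs \<le> sum_list xs" if "0 \<notin> set xs" for xs :: "nat list"
    using that by (induction xs) (auto simp: Suc_le_eq)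
  have "set (parts \<alpha>) \<subseteq> {..n} \<and> length (parts \<alpha>) \<le> n" if "weight \<alpha> \<le> n" for \<alpha>
    using that len [of "parts \<alpha>"] member_le_sum_list [of _ "parts \<alpha>"]
    by (force simp: weight_def)
  then have "parts ` {\<alpha>. weight \<alpha> \<le> n} \<subseteq> {xs. set xs \<subseteq> {..n} \<and> length xs \<le> n}"
    by blast
  moreover have "finite \<dots>"
    by (rule finite_lists_length_le) simp
  ultimately show ?thesis
    by (meson finite_subset finite_imageD inj_onI parts_inject)
qed

lemma finite_weight_eq: "finite {\<alpha>. weight \<alpha> = n}"
  by (rule finite_subset [OF _ finite_weight_le [of n]]) auto

lemma HH_add: "HH (\<alpha> + \<beta>) = HH \<alpha> * HH \<beta>"
  by (simp add: HH_def mult_single)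

lemma HH_conv_H: "HH \<alpha> = prod_list (map (\<lambda>a. H (int a)) (parts \<alpha>))"
proof -
  have "HH (Comp xs) = prod_list (map (\<lambda>a. H (int a)) xs)" if "0 \<notin> set xs" for xs
    using that
  proof (induction xs)
    case Nil
    have "Comp [] = 0" by (simp add: zero_comp_def)
    then show ?case by (simp add: HH_def)
  next
    case (Cons a xs)
    then have "Comp (a # xs) = Comp [a] + Comp xs"
      by (simp add: plus_comp_def Comp_inverse)
    with Cons show ?case by (auto simp: HH_add H_def)
  qed
  from this [of "parts \<alpha>"] show ?thesis by (simp add: parts_inverse)
qed

lemma finite_splittings: "finite {(p, q). p + q = (m :: monomial)}"
proof -
  have *: "finite {p :: monomial. \<forall>x. Poly_Mapping.lookup p x \<le> Poly_Mapping.lookup m x}"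
  proof (rule finite_imageD)
    let ?K = "Poly_Mapping.keys m"
    let ?B = "{..Max (insert 0 (Poly_Mapping.lookup m ` ?K))}"
    show "finite (Poly_Mapping.lookup ` {p :: monomial. \<forall>x. Poly_Mapping.lookup p x \<le> Poly_Mapping.lookup m x})"
    proof (rule finite_subset)
      show "Poly_Mapping.lookup ` {p. \<forall>x. Poly_Mapping.lookup p x \<le> Poly_Mapping.lookup m x}
          \<subseteq> {f. \<forall>x. (x \<in> ?K \<longrightarrow> f x \<in> ?B) \<and> (x \<notin> ?K \<longrightarrow> f x = 0)}"
      proof (intro subsetI CollectI allI)
        fix f x
        assume "f \<in> Poly_Mapping.lookup ` {p. \<forall>x. Poly_Mapping.lookup p x \<le> Poly_Mapping.lookup m x}"
        then have le: "f x \<le> Poly_Mapping.lookup m x"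
          by auto
        have "f x \<in> ?B" if "x \<in> ?K"
          using that le by (auto intro!: Max_ge [THEN order_trans [OF le]])
        moreover have "f x = 0" if "x \<notin> ?K"
          using that le by (simp add: in_keys_iff)
        ultimately show "(x \<in> ?K \<longrightarrow> f x \<in> ?B) \<and> (x \<notin> ?K \<longrightarrow> f x = 0)"
          by blast
      qed
      show "finite {f. \<forall>x. (x \<in> ?K \<longrightarrow> f x \<in> ?B) \<and> (x \<notin> ?K \<longrightarrow> f x = 0)}"
        by (rule finite_set_of_finite_funs) auto
    qed
    show "inj_on Poly_Mapping.lookup {p :: monomial. \<forall>x. Poly_Mapping.lookup p x \<le> Poly_Mapping.lookup m x}"
      by (meson inj_onI lookup_inject)
  qed
  let ?P = "{p :: monomial. \<forall>x. Poly_Mapping.lookup p x \<le> Poly_Mapping.lookup m x}"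
  have "{(p, q). p + q = m} \<subseteq> ?P \<times> ?P"
    by (auto simp: lookup_add)
  with * show ?thesis
    by (meson finite_SigmaI finite_subset)
qed

lemma lookup_mono_word:
  assumes "length is = length as" "distinct is"
  shows "Poly_Mapping.lookup (mono_word is as) x = (case map_of (zip is as) x of None \<Rightarrow> 0 | Some a \<Rightarrow> a)"
  using assms
proof (induction "is" as rule: list_induct2)
  case (Cons i "is" a as)
  then have "map_of (zip is as) i = None"
    by (simp add: map_of_zip_is_None)
  then have "(case map_of (zip is as) i of None \<Rightarrow> 0 | Some a \<Rightarrow> a) = 0"
    by (simp only: option.case)
  with Cons show ?case
    by (auto simp: mono_word_def lookup_add lookup_single)
qed (simp add: mono_word_def)

lemma map_lookup_mono_word:
  assumes "length is = length as" "distinct is"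
  shows "map (Poly_Mapping.lookup (mono_word is as)) is = as"
proof (rule nth_equalityI)
  fix k assume "k < length (map (Poly_Mapping.lookup (mono_word is as)) is)"
  then show "map (Poly_Mapping.lookup (mono_word is as)) is ! k = as ! k"
    using assms map_of_zip_nth [of "is" as k] by (simp add: lookup_mono_word)
qed (use assms in simp)

lemma keys_mono_word:
  assumes "length is = length as" "distinct is" "0 \<notin> set as"
  shows "Poly_Mapping.keys (mono_word is as) = set is"
proof -
  have "Poly_Mapping.lookup (mono_word is as) x \<noteq> 0" if "x \<in> set is" for x
    using that assms(3) map_lookup_mono_word [OF assms(1,2)] by (metis imageI list.set_map)
  moreover have "Poly_Mapping.lookup (mono_word is as) x = 0" if "x \<notin> set is" for x
  proof -
    have "map_of (zip is as) x = None"
      using that assms by (simp add: map_of_zip_is_None)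
    then show ?thesis
      by (simp only: lookup_mono_word [OF assms(1,2)] option.case)
  qed
  ultimately show ?thesis
    by (auto simp: in_keys_iff)
qed

lemma mdeg_mono_word:
  assumes "length is = length as" "distinct is" "0 \<notin> set as"
  shows "mdeg (mono_word is as) = sum_list as"
proof -
  have "mdeg (mono_word is as) = sum_list (map (Poly_Mapping.lookup (mono_word is as)) is)"
    using assms by (simp add: mdeg_def keys_mono_word sum_list_distinct_conv_sum_set)
  then show ?thesis
    using assms by (simp add: map_lookup_mono_word)
qed

lemma mono_word_inject:
  assumes "length is = length as" "sorted_wrt (<) is" "0 \<notin> set as"
    and "length js = length bs" "sorted_wrt (<) js" "0 \<notin> set bs"
    and eq: "mono_word is as = mono_word js bs"
  shows "is = js \<and> as = bs"
proof -
  have d: "distinct is" "distinct js"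
    using assms(2,5) by (simp_all add: strict_sorted_iff)
  have "set is = set js"
    using keys_mono_word [OF assms(1) d(1) assms(3)] keys_mono_word [OF assms(4) d(2) assms(6)] eq
    by simp
  then have "is = js"
    using assms(2,5) by (simp add: strict_sorted_equal)
  moreover have "as = bs"
    using map_lookup_mono_word [OF assms(1) d(1)] map_lookup_mono_word [OF assms(4) d(2)]
      eq \<open>is = js\<close> by metis
  ultimately show ?thesis by simp
qed

lemma monomial_cases:
  fixes m :: monomial
  obtains "is" \<alpha> where "sorted_wrt (<) is" "length is = length (parts \<alpha>)"
    "m = mono_word is (parts \<alpha>)"
proof -
  let ?is = "sorted_list_of_set (Poly_Mapping.keys m)"
  let ?as = "map (Poly_Mapping.lookup m) ?is"
  have "0 \<notin> set ?as"
    by (auto simp: in_keys_iff)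
  then have p: "parts (Comp ?as) = ?as"
    by (simp add: Comp_inverse)
  have "m = mono_word ?is ?as"
  proof (rule poly_mapping_eqI)
    fix x
    show "Poly_Mapping.lookup m x = Poly_Mapping.lookup (mono_word ?is ?as) x"
      by (simp add: lookup_mono_word map_of_zip_map in_keys_iff)
  qed
  with that [of ?is "Comp ?as"] p show thesis
    by simp
qed

lemma M_mono_word:
  assumes "sorted_wrt (<) is" "length is = length (parts \<alpha>)"
  shows "M \<beta> (mono_word is (parts \<alpha>)) = (if \<alpha> = \<beta> then 1 else 0)"
proof (cases "\<alpha> = \<beta>")
  case True
  then have "{js. sorted_wrt (<) js \<and> length js = length (parts \<beta>) \<and>
      mono_word js (parts \<beta>) = mono_word is (parts \<alpha>)} = {is}"
    using assms mono_word_inject [of _ "parts \<beta>" "is" "parts \<beta>"] by auto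
  with True show ?thesis by (simp add: M_def)
next
  case False
  then have "{js. sorted_wrt (<) js \<and> length js = length (parts \<beta>) \<and>
      mono_word js (parts \<beta>) = mono_word is (parts \<alpha>)} = {}"
    using assms mono_word_inject [of _ "parts \<beta>" "is" "parts \<alpha>"] by (auto simp: parts_inject)
  with False show ?thesis by (simp only: M_def card.empty if_False of_nat_0)
qed

lemma M_in_QSym_deg: "M \<alpha> \<in> QSym_deg (weight \<alpha>)"
proof -
  have deg: "mdeg m = weight \<alpha>" if "M \<alpha> m \<noteq> 0" for m
  proof (rule monomial_cases [of m])
    fix "is" \<beta>
    assume *: "sorted_wrt (<) is" "length is = length (parts \<beta>)" "m = mono_word is (parts \<beta>)"
    with that have "\<beta> = \<alpha>" by (auto simp: M_mono_word split: if_splits)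
    with * show "mdeg m = weight \<alpha>"
      by (simp add: mdeg_mono_word weight_def strict_sorted_iff)
  qed
  then show ?thesis
    by (auto simp: QSym_deg_def QSym_def M_mono_word)
qed

lemma M_in_QSym: "M \<alpha> \<in> QSym"
  using M_in_QSym_deg [of \<alpha>] by (simp add: QSym_deg_def)

lemma M_coeff_M: "M_coeff (M \<beta>) \<alpha> = (if \<alpha> = \<beta> then 1 else 0)"
  by (simp add: M_coeff_def M_mono_word)

lemma QSym_expansion:
  assumes "f \<in> QSym" "\<And>m. f m \<noteq> 0 \<Longrightarrow> mdeg m \<le> n"
  shows "f = (\<lambda>m. \<Sum>\<beta> | weight \<beta> \<le> n. M_coeff f \<beta> * M \<beta> m)"
proof
  fix m
  have sym: "f (mono_word is (parts \<alpha>)) = f (mono_word js (parts \<alpha>))"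
    if "sorted_wrt (<) is" "sorted_wrt (<) js"
      "length is = length (parts \<alpha>)" "length js = length (parts \<alpha>)" for \<alpha> "is" js
    using assms(1) that unfolding QSym_def by blast
  show "f m = (\<Sum>\<beta> | weight \<beta> \<le> n. M_coeff f \<beta> * M \<beta> m)"
  proof (rule monomial_cases [of m])
    fix "is" \<alpha>
    assume *: "sorted_wrt (<) is" "length is = length (parts \<alpha>)" "m = mono_word is (parts \<alpha>)"
    have "f m = M_coeff f \<alpha>"
      unfolding M_coeff_def *(3)
      by (rule sym) (use *(1,2) in simp_all)
    moreover have "mdeg m = weight \<alpha>"
      using * by (simp add: mdeg_mono_word weight_def strict_sorted_iff)
    ultimately have "f m = (if weight \<alpha> \<le> n then M_coeff f \<alpha> else 0)"
      using assms(2) [of m] by auto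
    also have "\<dots> = (\<Sum>\<beta> | weight \<beta> \<le> n. if \<alpha> = \<beta> then M_coeff f \<beta> else 0)"
      by (simp add: finite_weight_le)
    also have "\<dots> = (\<Sum>\<beta> | weight \<beta> \<le> n. M_coeff f \<beta> * M \<beta> m)"
      by (rule sum.cong) (use * in \<open>auto simp: M_mono_word\<close>)
    finally show ?thesis .
  qed
qed

lemma pairing_HH: "pairing (HH \<alpha>) f = M_coeff f \<alpha>"
  by (simp add: pairing_def HH_def)

lemma pairing_HH_M: "pairing (HH \<alpha>) (M \<beta>) = (if \<alpha> = \<beta> then 1 else 0)"
  by (simp add: pairing_HH M_coeff_M)

lemma pairing_M: "pairing h (M \<alpha>) = Poly_Mapping.lookup h \<alpha>"
  by (simp add: pairing_def M_coeff_M in_keys_iff if_distrib [of "(*) _"] cong: if_cong)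

lemma M_coeff_sum: "M_coeff (\<lambda>m. \<Sum>i\<in>A. c i * f i m) \<alpha> = (\<Sum>i\<in>A. c i * M_coeff (f i) \<alpha>)"
  by (simp add: M_coeff_def)

lemma pairing_sum: "pairing h (\<lambda>m. \<Sum>i\<in>A. c i * f i m) = (\<Sum>i\<in>A. c i * pairing h (f i))"
  unfolding pairing_def M_coeff_sum sum_distrib_left
  by (subst sum.swap) (simp add: mult_ac)

lemma series_mult_sum: "f \<star> (\<lambda>m. \<Sum>i\<in>A. c i * g i m) = (\<lambda>m. \<Sum>i\<in>A. c i * (f \<star> g i) m)"
proof
  fix m
  show "(f \<star> (\<lambda>m. \<Sum>i\<in>A. c i * g i m)) m = (\<Sum>i\<in>A. c i * (f \<star> g i) m)"
    unfolding series_mult_def sum_distrib_left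
    by (subst sum.swap) (simp add: sum_distrib_left case_prod_unfold mult_ac)
qed

lemma mdeg_add: "mdeg (p + q) = mdeg p + mdeg q"
proof -
  have *: "mdeg m = (\<Sum>i\<in>A. Poly_Mapping.lookup m i)" if "finite A" "Poly_Mapping.keys m \<subseteq> A" for m A
    unfolding mdeg_def by (rule sum.mono_neutral_left) (use that in \<open>auto simp: in_keys_iff\<close>)
  let ?A = "Poly_Mapping.keys p \<union> Poly_Mapping.keys q"
  show ?thesis
    using *[of ?A p] *[of ?A q] *[of ?A "p + q"] keys_add [of p q]
    by (simp add: lookup_add sum.distrib)
qed

lemma series_mult_mdeg:
  assumes "(f \<star> g) m \<noteq> 0"
  obtains p q where "f p \<noteq> 0" "g q \<noteq> 0" "mdeg m = mdeg p + mdeg q"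
proof -
  obtain pq where "pq \<in> {(p, q). p + q = m}" "(case pq of (p, q) \<Rightarrow> f p * g q) \<noteq> 0"
    using assms unfolding series_mult_def by (meson sum.not_neutral_contains_not_neutral)
  then show thesis
    using that by (auto simp: mdeg_add)
qed

lemma M_coeff_nonzero_mdeg:
  assumes "M_coeff f \<alpha> \<noteq> 0"
  obtains m where "f m \<noteq> 0" "mdeg m = weight \<alpha>"
  using assms that [of "mono_word [0..<length (parts \<alpha>)] (parts \<alpha>)"]
  by (auto simp: M_coeff_def weight_def mdeg_mono_word)

lemma pairing_nonzero_mdeg:
  assumes "pairing h f \<noteq> 0"
  obtains \<alpha> m where "\<alpha> \<in> Poly_Mapping.keys h" "f m \<noteq> 0" "mdeg m = weight \<alpha>"
proof -
  obtain \<alpha> where "\<alpha> \<in> Poly_Mapping.keys h" "M_coeff f \<alpha> \<noteq> 0"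
    using assms unfolding pairing_def
    by (metis (no_types, lifting) mult_zero_right sum.not_neutral_contains_not_neutral)
  then show thesis
    using that by (metis M_coeff_nonzero_mdeg)
qed

lemma nsym_weight_bound: "\<exists>d. \<forall>\<alpha>\<in>Poly_Mapping.keys (h :: nsym). weight \<alpha> \<le> d"
  using finite_nat_set_iff_bounded_le [of "weight ` Poly_Mapping.keys h"] by auto

lemma perp_exists: "\<exists>h'. \<forall>g\<in>QSym. pairing h' g = pairing h (f \<star> g)"
proof -
  obtain d where d: "\<And>\<alpha>. \<alpha> \<in> Poly_Mapping.keys h \<Longrightarrow> weight \<alpha> \<le> d"
    using nsym_weight_bound by blast
  have "weight \<beta> \<le> d" if nz: "pairing h (f \<star> M \<beta>) \<noteq> 0" for \<beta>
  proof -
    obtain \<alpha> m where "\<alpha> \<in> Poly_Mapping.keys h" "(f \<star> M \<beta>) m \<noteq> 0" "mdeg m = weight \<alpha>"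
      using nz by (rule pairing_nonzero_mdeg)
    moreover then obtain p q where "M \<beta> q \<noteq> 0" "mdeg m = mdeg p + mdeg q"
      by (meson series_mult_mdeg)
    ultimately show ?thesis
      using d [of \<alpha>] M_in_QSym_deg [of \<beta>] by (auto simp: QSym_deg_def)
  qed
  then have "finite {\<beta>. pairing h (f \<star> M \<beta>) \<noteq> 0}"
    by (intro finite_subset [OF _ finite_weight_le [of d]]) auto
  then have l: "Poly_Mapping.lookup (Abs_poly_mapping (\<lambda>\<beta>. pairing h (f \<star> M \<beta>))) = (\<lambda>\<beta>. pairing h (f \<star> M \<beta>))"
    by simp
  show ?thesis
  proof (intro exI ballI)
    fix g assume g: "g \<in> QSym"
    then obtain n where n: "\<And>m. g m \<noteq> 0 \<Longrightarrow> mdeg m \<le> n"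
      by (auto simp: QSym_def)
    let ?h = "Abs_poly_mapping (\<lambda>\<beta>. pairing h (f \<star> M \<beta>))"
    note e = QSym_expansion [OF g n]
    have "pairing ?h g = (\<Sum>\<beta> | weight \<beta> \<le> n. M_coeff g \<beta> * pairing ?h (M \<beta>))"
      by (subst e) (simp_all add: pairing_sum)
    also have "\<dots> = (\<Sum>\<beta> | weight \<beta> \<le> n. M_coeff g \<beta> * pairing h (f \<star> M \<beta>))"
      by (simp add: pairing_M l)
    also have "\<dots> = pairing h (f \<star> g)"
      by (subst (2) e) (simp_all add: pairing_sum series_mult_sum)
    finally show "pairing ?h g = pairing h (f \<star> g)" .
  qed
qed

lemma nsym_eqI:
  assumes "\<And>g. g \<in> QSym \<Longrightarrow> pairing h g = pairing h' g"
  shows "h = h'"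
  by (rule poly_mapping_eqI) (metis assms M_in_QSym pairing_M)

lemma pairing_perp: "g \<in> QSym \<Longrightarrow> pairing (perp f h) g = pairing h (f \<star> g)"
proof -
  have "\<exists>!h'. \<forall>g\<in>QSym. pairing h' g = pairing h (f \<star> g)"
    using perp_exists by (auto intro: nsym_eqI)
  from theI' [OF this] show "g \<in> QSym \<Longrightarrow> ?thesis"
    by (simp add: perp_def)
qed

lemma perp_eqI: "(\<And>g. g \<in> QSym \<Longrightarrow> pairing h' g = pairing h (f \<star> g)) \<Longrightarrow> perp f h = h'"
  by (rule nsym_eqI) (simp add: pairing_perp)

lemma finite_BB_support:
  "finite {i. (-1) ^ i * H (m + int i) * perp (F (ones i)) h \<noteq> 0}"
proof -
  obtain d where d: "\<And>\<alpha>. \<alpha> \<in> Poly_Mapping.keys h \<Longrightarrow> weight \<alpha> \<le> d"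
    using nsym_weight_bound by blast
  have i_le: "i \<le> d" if nz: "perp (F (ones i)) h \<noteq> 0" for i
  proof -
    obtain \<beta> where "pairing (perp (F (ones i)) h) (M \<beta>) \<noteq> 0"
      using nz by (metis pairing_M lookup_zero poly_mapping_eqI)
    then have "pairing h (F (ones i) \<star> M \<beta>) \<noteq> 0"
      by (simp add: pairing_perp M_in_QSym)
    then obtain \<alpha> m where 1: "\<alpha> \<in> Poly_Mapping.keys h" "(F (ones i) \<star> M \<beta>) m \<noteq> 0"
        "mdeg m = weight \<alpha>"
      by (rule pairing_nonzero_mdeg)
    then obtain p q where 2: "F (ones i) p \<noteq> 0" "mdeg m = mdeg p + mdeg q"
      by (meson series_mult_mdeg)
    then obtain \<gamma> where 3: "refines \<gamma> (ones i)" "M \<gamma> p \<noteq> 0"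
      unfolding F_def by (metis (mono_tags, lifting) mem_Collect_eq sum.not_neutral_contains_not_neutral)
    have "weight (ones i) = i"
      unfolding weight_def by transfer (simp add: sum_list_replicate)
    with 3 have "mdeg p = i"
      using M_in_QSym_deg [of \<gamma>] by (auto simp: QSym_deg_def refines_def)
    with 1 2 d show ?thesis by fastforce
  qed
  have "{i. (-1) ^ i * H (m + int i) * perp (F (ones i)) h \<noteq> 0} \<subseteq> {..d}"
  proof (intro subsetI, unfold mem_Collect_eq atMost_iff)
    fix i
    assume "(-1) ^ i * H (m + int i) * perp (F (ones i)) h \<noteq> 0"
    then have "perp (F (ones i)) h \<noteq> 0"
      by (rule contrapos_nn) (simp only: mult_zero_right)
    then show "i \<le> d"
      by (rule i_le)
  qed
  then show ?thesis
    by (rule finite_subset) simp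
qed

lemma finite_immaculate_tableaux: "finite {T. immaculate_tableau \<alpha> \<beta> T}"
proof -
  let ?R = "{xs :: nat list. set xs \<subseteq> {..length (parts \<beta>)} \<and> length xs \<le> weight \<alpha>}"
  have R: "row \<in> ?R" if T: "immaculate_tableau \<alpha> \<beta> T" and row: "row \<in> set T" for T row
  proof -
    have "x \<le> length (parts \<beta>)" if "x \<in> set row" for x
    proof (rule ccontr)
      assume x: "\<not> x \<le> length (parts \<beta>)"
      then have "count_list (concat T) x = 0"
        using T unfolding immaculate_tableau_def by simp
      then show False
        using row that by (auto simp: count_list_0_iff)
    qed
    moreover have "length row \<in> set (parts \<alpha>)"
      using T row unfolding immaculate_tableau_def by (metis image_eqI list.set_map)
    ultimately show ?thesis
      by (auto simp: weight_def intro: member_le_sum_list)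
  qed
  have L: "length T = length (parts \<alpha>)" if "immaculate_tableau \<alpha> \<beta> T" for T
    using that unfolding immaculate_tableau_def by (metis length_map)
  have "finite ?R"
    by (rule finite_lists_length_le) simp
  then have "finite {T. set T \<subseteq> ?R \<and> length T = length (parts \<alpha>)}"
    by (rule finite_lists_length_eq)
  then show ?thesis
    by (rule rev_finite_subset) (use R L in auto)
qed

end

theory Submission
  imports Defs
begin

text \<open>On a word \<open>H\<^sub>\<gamma>\<close> the operator \<open>F\<^bsub>1\<^sup>i\<^esub>\<^sup>\<bottom>\<close> lowers \<open>i\<close> of the letters by one, so
  \<open>F\<^bsub>1\<^sup>i\<^esub>\<^sup>\<bottom> (f H\<^sub>s) = F\<^bsub>1\<^sup>i\<^esub>\<^sup>\<bottom> f H\<^sub>s + F\<^bsub>1\<^sup>i\<^sup>-\<^sup>1\<^esub>\<^sup>\<bottom> f H\<^bsub>s-1\<^esub>\<close>. This gives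
  \<open>\<bbbB>\<^sub>m f H\<^sub>s = \<bbbB>\<^sub>m (f H\<^sub>s) + \<bbbB>\<^bsub>m+1\<^esub> f H\<^bsub>s-1\<^esub>\<close>, and iterating it yields a positive Pieri rule for right
  multiplication of immaculate functions by \<open>H\<^sub>s\<close>. Adding the letters of a tableau from the smallest to the
  largest then shows \<open>H\<^sub>\<beta> = \<Sum> K\<^bsub>\<alpha>,\<beta>\<^esub> \<SS>\<^sub>\<alpha>\<close>. Since \<open>K\<close> is unitriangular in the lexicographic order, this
  can be inverted, which identifies the dual basis.\<close>

section \<open>Linearity\<close>

lemma pairing_superset:
  assumes "finite A" "Poly_Mapping.keys h \<subseteq> A"
  shows "pairing h f = (\<Sum>\<alpha>\<in>A. Poly_Mapping.lookup h \<alpha> * M_coeff f \<alpha>)"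
  unfolding pairing_def by (rule sum.mono_neutral_left) (use assms in \<open>auto simp: in_keys_iff\<close>)

lemma pairing_zero [simp]: "pairing 0 f = 0"
  by (simp add: pairing_def)

lemma pairing_add: "pairing (g + h) f = pairing g f + pairing h f"
proof -
  let ?A = "Poly_Mapping.keys g \<union> Poly_Mapping.keys h"
  show ?thesis
    using keys_add [of g h]
    by (simp add: pairing_superset [of ?A] lookup_add distrib_right sum.distrib)
qed

lemma pairing_sum_left: "pairing (\<Sum>x\<in>A. h x) f = (\<Sum>x\<in>A. pairing (h x) f)"
  by (induction A rule: infinite_finite_induct) (simp_all add: pairing_add)

lemma pairing_single: "pairing (Poly_Mapping.single \<alpha> c) f = c * M_coeff f \<alpha>"
  by (simp add: pairing_def)

lemma perp_add: "perp f (g + h) = perp f g + perp f h"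
  by (rule perp_eqI) (simp add: pairing_add pairing_perp)

lemma BB_add: "BB m (g + h) = BB m g + BB m h"
  unfolding BB_def perp_add distrib_left
  by (rule Sum_any.distrib) (rule finite_BB_support)+

lemma BB_zero [simp]: "BB m 0 = 0"
  using BB_add [of m 0 0] by simp

lemma BB_sum: "BB m (\<Sum>x\<in>A. h x) = (\<Sum>x\<in>A. BB m (h x))"
  by (induction A rule: infinite_finite_induct) (simp_all add: BB_add)

section \<open>The operators dual to multiplication by a fundamental function\<close>

lemma parts_ones [simp]: "parts (ones i) = replicate i 1"
  by transfer simp

lemma parts_zero [simp]: "parts 0 = []"
  by (rule zero_comp.rep_eq)

lemma parts_plus: "parts (\<alpha> + \<beta>) = parts \<alpha> @ parts \<beta>"
  by (rule plus_comp.rep_eq)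

lemma length_le_sum_list: "0 \<notin> set xs \<Longrightarrow> length xs \<le> sum_list (xs :: nat list)"
  by (induction xs) (auto simp: Suc_le_eq)

lemma eq_replicate_one:
  assumes "0 \<notin> set xs" "sum_list xs \<le> length (xs :: nat list)"
  shows "xs = replicate (length xs) 1"
  using assms
proof (induction xs)
  case (Cons x xs)
  moreover have "x \<ge> 1" "length xs \<le> sum_list xs"
    using Cons.prems length_le_sum_list [of xs] by (auto simp: Suc_le_eq)
  ultimately have "x = 1" "xs = replicate (length xs) 1"
    by auto
  then show ?case
    by (metis length_Cons replicate_Suc)
qed simp

text \<open>The partial sums of \<open>ones i\<close> fill \<open>{1..<i}\<close>, so a refinement
  has at least \<open>i\<close> parts; as its weight is \<open>i\<close>, every part is 1.\<close>

lemma refines_ones_iff: "refines \<beta> (ones i) \<longleftrightarrow> \<beta> = ones i"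
proof
  assume r: "refines \<beta> (ones i)"
  then have w: "sum_list (parts \<beta>) = i"
    by (simp add: refines_def weight_def sum_list_replicate)
  have "{1..<i} \<subseteq> partial_sums (ones i)"
    by (force simp: partial_sums_def sum_list_replicate)
  also have "\<dots> \<subseteq> partial_sums \<beta>"
    using r by (simp add: refines_def)
  also have "\<dots> = (\<lambda>k. sum_list (take k (parts \<beta>))) ` {1..<length (parts \<beta>)}"
    by (auto simp: partial_sums_def)
  finally have "card {1..<i} \<le> card {1..<length (parts \<beta>)}"
    by (meson card_image_le card_mono finite_atLeastLessThan finite_imageI order_trans)
  moreover have "parts \<beta> = [] \<Longrightarrow> i = 0"
    using w by simp
  ultimately have "i \<le> length (parts \<beta>)"
    by (cases "parts \<beta>") auto
  then have "length (parts \<beta>) = i" "parts \<beta> = replicate (length (parts \<beta>)) 1"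
    using w length_le_sum_list [of "parts \<beta>"] eq_replicate_one [of "parts \<beta>"] by auto
  then show "\<beta> = ones i"
    by (metis parts_inject parts_ones)
qed (simp add: refines_def)

section \<open>Products with elementary symmetric functions\<close>

lemma F_ones: "F (ones i) = M (ones i)"
  by (simp add: F_def refines_ones_iff)

text \<open>For finite \<open>S\<close> these are the monomials of the elementary symmetric function
  of degree \<open>card S\<close>, which is \<open>M (ones (card S))\<close>.\<close>

definition squarefree_monomial :: "nat set \<Rightarrow> monomial" where
  "squarefree_monomial S = (\<Sum>j\<in>S. Poly_Mapping.single j 1)"

lemma lookup_squarefree_monomial:
  "finite S \<Longrightarrow> Poly_Mapping.lookup (squarefree_monomial S) j = of_bool (j \<in> S)"
  by (simp add: squarefree_monomial_def lookup_sum lookup_single when_def)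

lemma keys_squarefree_monomial: "finite S \<Longrightarrow> Poly_Mapping.keys (squarefree_monomial S) = S"
  by (auto simp: in_keys_iff lookup_squarefree_monomial)

lemma mono_word_replicate_one:
  "distinct js \<Longrightarrow> mono_word js (replicate (length js) 1) = squarefree_monomial (set js)"
  by (induction js) (auto simp: mono_word_def squarefree_monomial_def)

lemma M_ones_squarefree: "finite S \<Longrightarrow> M (ones (card S)) (squarefree_monomial S) = 1"
  using M_mono_word [of "sorted_list_of_set S" "ones (card S)" "ones (card S)"]
    mono_word_replicate_one [of "sorted_list_of_set S"]
  by simp

lemma M_ones_nonzero:
  assumes "M (ones i) p \<noteq> 0"
  obtains S where "finite S" "card S = i" "p = squarefree_monomial S"
proof -
  have "{js. sorted_wrt (<) js \<and> length js = length (parts (ones i)) \<and>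
      mono_word js (parts (ones i)) = p} \<noteq> {}"
    using assms unfolding M_def by (rule contrapos_nn) (simp only: card.empty of_nat_0)
  then obtain js where "sorted_wrt (<) js" "length js = i" "mono_word js (replicate i 1) = p"
    by auto
  then show thesis
    using that [of "set js"] mono_word_replicate_one [of js]
    by (auto simp: strict_sorted_iff distinct_card)
qed

text \<open>By quasi-symmetry only the nonzero exponents and their order matter. Gaps have to be
  allowed because dividing out a variable of exponent 1 leaves a zero exponent.\<close>

lemma QSym_apply:
  assumes "g \<in> QSym" "Poly_Mapping.keys q \<subseteq> {..<n}"
  shows "g q = M_coeff g (Comp (filter ((\<noteq>) 0) (map (Poly_Mapping.lookup q) [0..<n])))"
proof (rule monomial_cases [of q])
  fix js \<alpha>
  assume *: "sorted_wrt (<) js" "length js = length (parts \<alpha>)" "q = mono_word js (parts \<alpha>)"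
  then have k: "Poly_Mapping.keys q = set js"
    by (simp add: keys_mono_word strict_sorted_iff)
  have "filter (\<lambda>j. 0 \<noteq> Poly_Mapping.lookup q j) [0..<n] = js"
  proof (rule strict_sorted_equal)
    show "sorted_wrt (<) (filter (\<lambda>j. 0 \<noteq> Poly_Mapping.lookup q j) [0..<n])"
      by (simp add: sorted_wrt_filter)
    show "set (filter (\<lambda>j. 0 \<noteq> Poly_Mapping.lookup q j) [0..<n]) = set js"
      using assms(2) by (auto simp: k [symmetric] in_keys_iff)
  qed (use * in simp)
  then have "filter ((\<noteq>) 0) (map (Poly_Mapping.lookup q) [0..<n]) = parts \<alpha>"
    using map_lookup_mono_word [of js "parts \<alpha>"] *
    by (simp add: filter_map o_def strict_sorted_iff)
  moreover have "g q = M_coeff g \<alpha>"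
  proof -
    have sym: "g (mono_word is (parts \<alpha>)) = g (mono_word ls (parts \<alpha>))"
      if "sorted_wrt (<) is" "sorted_wrt (<) ls"
        "length is = length (parts \<alpha>)" "length ls = length (parts \<alpha>)" for "is" ls
      using assms(1) that unfolding QSym_def by blast
    show ?thesis
      unfolding M_coeff_def *(3) by (rule sym) (use * in simp_all)
  qed
  ultimately show ?thesis
    by (simp add: parts_inverse)
qed

text \<open>Positions are marked rather than values, since equal letters are lowered independently.
  Letters that reach 0 are dropped, in accordance with \<open>H 0 = 1\<close>.\<close>

definition lower :: "nat set \<Rightarrow> nat list \<Rightarrow> comp" where
  "lower S xs = Comp (filter ((\<noteq>) 0) (map (\<lambda>j. xs ! j - of_bool (j \<in> S)) [0..<length xs]))"

text \<open>In a factorisation of the monomial of \<gamma>, the first factor must be squarefree with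
  some support \<open>S\<close>. The cofactor then has the exponents on \<open>S\<close> lowered by
  one, and quasi-symmetry gives its coefficient in \<open>g\<close>.\<close>

lemma M_coeff_M_ones_mult:
  assumes "g \<in> QSym"
  shows "M_coeff (M (ones i) \<star> g) \<gamma> =
    (\<Sum>S | S \<subseteq> {..<length (parts \<gamma>)} \<and> card S = i. M_coeff g (lower S (parts \<gamma>)))"
proof -
  let ?xs = "parts \<gamma>" and ?n = "length (parts \<gamma>)"
  let ?m = "mono_word [0..<?n] ?xs"
  let ?x = squarefree_monomial
  have m: "Poly_Mapping.lookup ?m j = ?xs ! j" if "j < ?n" for j
    using map_lookup_mono_word [of "[0..<?n]" ?xs] that
    by (metis (no_types, lifting) add_0 distinct_upt length_upt minus_nat.diff_0 nth_map nth_upt)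
  have km: "Poly_Mapping.keys ?m = {..<?n}"
    by (simp add: keys_mono_word lessThan_atLeast0)
  have pos: "?xs ! j > 0" if "j < ?n" for j
    using that zero_notin_parts [of \<gamma>] by (metis gr0I nth_mem)
  \<comment> \<open>All exponents of \<open>?m\<close> at positions in \<open>S\<close> are
    positive, so the truncated subtraction is exact.\<close>
  have split: "?x S + (?m - ?x S) = ?m" if "S \<subseteq> {..<?n}" for S
  proof (rule poly_mapping_eqI)
    fix j
    show "Poly_Mapping.lookup (?x S + (?m - ?x S)) j = Poly_Mapping.lookup ?m j"
      using that pos [of j] m [of j] finite_subset [OF that]
      by (auto simp: lookup_add lookup_minus lookup_squarefree_monomial)
  qed
  have val: "g (?m - ?x S) = M_coeff g (lower S ?xs)" if "S \<subseteq> {..<?n}" for S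
  proof -
    have fin: "finite S"
      using that finite_subset by blast
    have "Poly_Mapping.keys (?m - ?x S) \<subseteq> {..<?n}"
      unfolding km [symmetric] by (auto simp: in_keys_iff lookup_minus)
    moreover have "map (Poly_Mapping.lookup (?m - ?x S)) [0..<?n] =
        map (\<lambda>j. ?xs ! j - of_bool (j \<in> S)) [0..<?n]"
      by (simp add: lookup_minus lookup_squarefree_monomial fin m)
    ultimately show ?thesis
      using QSym_apply [OF assms, of "?m - ?x S" ?n] by (simp only: lower_def)
  qed
  have "M_coeff (M (ones i) \<star> g) \<gamma> = (\<Sum>(p, q) | p + q = ?m. M (ones i) p * g q)"
    by (simp add: M_coeff_def series_mult_def)
  also have "\<dots> = (\<Sum>(p, q) | p + q = ?m \<and> M (ones i) p \<noteq> 0. M (ones i) p * g q)"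
    by (rule sum.mono_neutral_right [OF finite_splittings]) auto
  \<comment> \<open>A contributing pair is determined by the support of its first factor, since the
    second is the cofactor.\<close>
  also have "\<dots> = (\<Sum>S | S \<subseteq> {..<?n} \<and> card S = i. g (?m - ?x S))"
  proof (rule sum.reindex_bij_witness
      [where i = "\<lambda>S. (?x S, ?m - ?x S)" and j = "\<lambda>(p, q). Poly_Mapping.keys p"])
    fix a assume "a \<in> {(p, q). p + q = ?m \<and> M (ones i) p \<noteq> 0}"
    then obtain p q where a: "a = (p, q)" "p + q = ?m" "M (ones i) p \<noteq> 0"
      by auto
    then obtain S where S: "finite S" "card S = i" "p = ?x S"
      using M_ones_nonzero by blast
    have q: "q = ?m - ?x S"
      using a(2) S(3) by (metis add_diff_cancel_left')
    have "Poly_Mapping.keys p \<subseteq> Poly_Mapping.keys ?m"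
      unfolding a(2) [symmetric] by (auto simp: in_keys_iff lookup_add)
    then show "(case a of (p, q) \<Rightarrow> Poly_Mapping.keys p) \<in> {S. S \<subseteq> {..<?n} \<and> card S = i}"
      using a S by (simp add: keys_squarefree_monomial km)
    show "(?x (case a of (p, q) \<Rightarrow> Poly_Mapping.keys p),
        ?m - ?x (case a of (p, q) \<Rightarrow> Poly_Mapping.keys p)) = a"
      using a S q by (simp add: keys_squarefree_monomial)
    show "g (?m - ?x (case a of (p, q) \<Rightarrow> Poly_Mapping.keys p)) =
        (case a of (p, q) \<Rightarrow> M (ones i) p * g q)"
      using a S q M_ones_squarefree [of S] by (simp add: keys_squarefree_monomial)
  next
    fix S assume "S \<in> {S. S \<subseteq> {..<?n} \<and> card S = i}"
    then have S: "S \<subseteq> {..<?n}" "card S = i" "finite S"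
      using finite_subset by auto
    then show "(case (?x S, ?m - ?x S) of (p, q) \<Rightarrow> Poly_Mapping.keys p) = S"
      by (simp add: keys_squarefree_monomial)
    show "(?x S, ?m - ?x S) \<in> {(p, q). p + q = ?m \<and> M (ones i) p \<noteq> 0}"
      using S split [of S] M_ones_squarefree [of S] by simp
  qed
  also have "\<dots> = (\<Sum>S | S \<subseteq> {..<?n} \<and> card S = i. M_coeff g (lower S ?xs))"
    by (rule sum.cong) (simp_all add: val)
  finally show ?thesis .
qed

text \<open>The adjoint form of \<open>M_coeff_M_ones_mult\<close>: both sides have the same pairing
  with every quasi-symmetric \<open>g\<close>.\<close>

lemma perp_F_ones_single:
  "perp (F (ones i)) (Poly_Mapping.single \<gamma> c) =
    (\<Sum>S | S \<subseteq> {..<length (parts \<gamma>)} \<and> card S = i. Poly_Mapping.single (lower S (parts \<gamma>)) c)"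
  by (rule perp_eqI)
    (simp add: F_ones pairing_sum_left pairing_single M_coeff_M_ones_mult sum_distrib_left)

text \<open>The filtered list covers \<open>s = 0\<close>, where \<open>H\<close> is the unit,
  uniformly with \<open>s > 0\<close>; this is what a last letter lowered to 0 requires.\<close>

lemma H_nat: "H (int s) = HH (Comp (filter ((\<noteq>) 0) [s]))"
  by (simp add: H_def HH_def flip: zero_comp_def)

lemma Comp_append:
  "0 \<notin> set xs \<Longrightarrow> 0 \<notin> set ys \<Longrightarrow> Comp (xs @ ys) = Comp xs + Comp ys"
  by (simp add: plus_comp_def Comp_inverse)

lemma lower_snoc:
  "lower S (xs @ [s]) = lower S xs + Comp (filter ((\<noteq>) 0) [s - of_bool (length xs \<in> S)])"
  unfolding lower_def
  by (subst Comp_append [symmetric]) (auto simp: nth_append intro!: arg_cong [of _ _ Comp] filter_cong map_cong)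

text \<open>Pascal's rule for sets, by whether \<open>n\<close> is a member. Here \<open>n\<close>
  will be the position of the last letter.\<close>

lemma subsets_lessThan_Suc_card:
  "{S. S \<subseteq> {..<Suc n} \<and> card S = Suc i} =
    {S. S \<subseteq> {..<n} \<and> card S = Suc i} \<union> insert n ` {S. S \<subseteq> {..<n} \<and> card S = i}"
  (is "?L = ?A \<union> ?B")
proof
  show "?L \<subseteq> ?A \<union> ?B"
  proof
    fix S assume S: "S \<in> ?L"
    show "S \<in> ?A \<union> ?B"
    proof (cases "n \<in> S")
      case True
      then have "S = insert n (S - {n})" "S - {n} \<subseteq> {..<n}" "card (S - {n}) = i"
        using S finite_subset [of S "{..<Suc n}"] by (auto simp: card_Diff_singleton less_Suc_eq)
      then show ?thesis by blast
    qed (use S in \<open>auto simp: less_Suc_eq\<close>)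
  qed
  show "?A \<union> ?B \<subseteq> ?L"
  proof -
    have "insert n S \<in> ?L" if "S \<subseteq> {..<n}" "card S = i" for S
      using that finite_subset [OF that(1)] by (auto simp: card_insert_if)
    then show ?thesis by (auto simp: less_Suc_eq)
  qed
qed

text \<open>Either the last letter keeps its value and \<open>i\<close> earlier letters are lowered,
  or it becomes \<open>s - 1\<close> and only \<open>i - 1\<close> earlier ones are. The assumption
  \<open>s > 0\<close> makes it a genuine position of the word; the case \<open>i = 0\<close> has no
  second term.\<close>

lemma perp_F_ones_mult_H_single:
  assumes "s > 0"
  shows "perp (F (ones i)) (Poly_Mapping.single \<gamma> c * H (int s)) =
    perp (F (ones i)) (Poly_Mapping.single \<gamma> c) * H (int s) +
    (if i = 0 then 0 else perp (F (ones (i - 1))) (Poly_Mapping.single \<gamma> c)) * H (int (s - 1))"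
proof -
  let ?xs = "parts \<gamma>"
  let ?n = "length ?xs"
  let ?sg = "\<lambda>S. Poly_Mapping.single (lower S (?xs @ [s])) c"
  have H: "Poly_Mapping.single \<delta> c * H (int t) =
      Poly_Mapping.single (\<delta> + Comp (filter ((\<noteq>) 0) [t])) c" for \<delta> t
    by (simp add: H_nat HH_def mult_single)
  have p: "parts (\<gamma> + Comp (filter ((\<noteq>) 0) [s])) = ?xs @ [s]"
    using assms by (simp add: parts_plus Comp_inverse)
  have out: "?sg S = Poly_Mapping.single (lower S ?xs) c * H (int s)" if "S \<subseteq> {..<?n}" for S
    using that by (auto simp: H lower_snoc)
  have inn: "?sg (insert ?n S) = Poly_Mapping.single (lower S ?xs) c * H (int (s - 1))"
    if "S \<subseteq> {..<?n}" for S
  proof -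
    have "lower (insert ?n S) ?xs = lower S ?xs"
      by (auto simp: lower_def intro!: arg_cong [of _ _ Comp] filter_cong map_cong)
    then show ?thesis
      by (simp add: H lower_snoc)
  qed
  have outs: "(\<Sum>S | S \<subseteq> {..<?n} \<and> card S = i. ?sg S) =
      perp (F (ones i)) (Poly_Mapping.single \<gamma> c) * H (int s)" for i
    unfolding perp_F_ones_single sum_distrib_right by (rule sum.cong) (auto simp: out)
  have lhs: "perp (F (ones i)) (Poly_Mapping.single \<gamma> c * H (int s)) =
      (\<Sum>S | S \<subseteq> {..<Suc ?n} \<and> card S = i. ?sg S)"
    unfolding H perp_F_ones_single p by simp
  show ?thesis
  proof (cases i)
    case 0
    have "{S. S \<subseteq> {..<n} \<and> card S = 0} = {{}}" for n :: nat
      by (auto simp: card_eq_0_iff dest: finite_subset [OF _ finite_lessThan])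
    with outs [of 0] 0 lhs show ?thesis
      by simp
  next
    case (Suc k)
    have "(\<Sum>S | S \<subseteq> {..<Suc ?n} \<and> card S = i. ?sg S) =
        (\<Sum>S | S \<subseteq> {..<?n} \<and> card S = i. ?sg S) +
        (\<Sum>S\<in>insert ?n ` {S. S \<subseteq> {..<?n} \<and> card S = k}. ?sg S)"
      unfolding Suc subsets_lessThan_Suc_card
      by (rule sum.union_disjoint) (auto intro!: finite_subset [of _ "Pow {..<?n}"])
    also have "(\<Sum>S\<in>insert ?n ` {S. S \<subseteq> {..<?n} \<and> card S = k}. ?sg S) =
        (\<Sum>S | S \<subseteq> {..<?n} \<and> card S = k. ?sg (insert ?n S))"
    proof (rule sum.reindex_cong [of "insert ?n"])
      show "inj_on (insert ?n) {S. S \<subseteq> {..<?n} \<and> card S = k}"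
        by (rule inj_onI, subst (asm) insert_ident) auto
    qed simp_all
    also have "\<dots> = perp (F (ones k)) (Poly_Mapping.single \<gamma> c) * H (int (s - 1))"
      unfolding perp_F_ones_single sum_distrib_right by (rule sum.cong) (auto simp: inn)
    finally show ?thesis
      using Suc lhs outs [of i] by simp
  qed
qed

lemma perp_F_ones_mult_H:
  assumes "s > 0"
  shows "perp (F (ones i)) (f * H (int s)) =
    perp (F (ones i)) f * H (int s) +
    (if i = 0 then 0 else perp (F (ones (i - 1))) f) * H (int (s - 1))"
proof (induction f rule: update_induct)
  case const
  have "perp (F (ones i)) 0 = 0" for i
    by (rule perp_eqI) simp
  then show ?case by simp
next
  case (update f \<gamma> c)
  \<comment> \<open>The key is fresh, so the update is an addition and the claim follows by
    linearity.\<close>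
  have "Poly_Mapping.update \<gamma> c f = Poly_Mapping.single \<gamma> c + f"
    using update.hyps(1)
    by (intro poly_mapping_eqI)
      (auto simp: lookup_update lookup_add lookup_single in_keys_iff when_def)
  with update.IH perp_F_ones_mult_H_single [OF assms, of i \<gamma> c] show ?case
    by (simp add: distrib_right perp_add)
qed

lemma perp_F_ones_one: "perp (F (ones i)) 1 = (if i = 0 then 1 else 0)"
proof -
  have "lower {} [] = 0"
    by (simp add: lower_def zero_comp_def)
  moreover have "{S :: nat set. S = {} \<and> card S = i} = (if i = 0 then {{}} else {})"
    by auto
  ultimately show ?thesis
    using perp_F_ones_single [of i 0 1] by simp
qed

section \<open>Creation operators and the right Pieri rule\<close>

lemma BB_one: "BB m 1 = H m"
proof -
  have "BB m 1 = Sum_any (\<lambda>i :: nat. if i = 0 then H m else 0)"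
    unfolding BB_def by (rule arg_cong [of _ _ Sum_any]) (auto simp: perp_F_ones_one)
  then show ?thesis
    by (simp add: Sum_any.expand_set)
qed

text \<open>Every large enough cutoff is allowed, so that several such sums can be brought to
  compatible ranges.\<close>

lemma BB_eq_sum:
  "\<exists>N. \<forall>n\<ge>N. BB m h = (\<Sum>i<n. (-1) ^ i * H (m + int i) * perp (F (ones i)) h)"
proof -
  let ?t = "\<lambda>i. (-1) ^ i * H (m + int i) * perp (F (ones i)) h"
  obtain N where N: "\<forall>i\<in>{i. ?t i \<noteq> 0}. i < N"
    using iffD1 [OF finite_nat_set_iff_bounded finite_BB_support] by (rule exE)
  have "BB m h = sum ?t {..<n}" if "n \<ge> N" for n
    unfolding BB_def
  proof (rule Sum_any.expand_superset)
    show "{i. ?t i \<noteq> 0} \<subseteq> {..<n}"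
      by (rule subsetI, drule bspec [OF N]) (simp only: lessThan_iff less_le_trans [OF _ that])
  qed simp
  then show ?thesis by blast
qed

text \<open>Apply \<open>perp_F_ones_mult_H\<close> termwise. In the part with the last letter
  lowered, shifting \<open>i\<close> by one reads the index \<open>m + i\<close> as
  \<open>(m + 1) + (i - 1)\<close> and flips the sign.\<close>

lemma BB_mult_H:
  assumes "s > 0"
  shows "BB m (f * H (int s)) = BB m f * H (int s) - BB (m + 1) f * H (int (s - 1))"
proof -
  let ?t = "\<lambda>m h i. (-1) ^ i * H (m + int i) * perp (F (ones i)) h"
  obtain N1 where N1: "\<And>n. n \<ge> N1 \<Longrightarrow> BB m (f * H (int s)) = (\<Sum>i<n. ?t m (f * H (int s)) i)"
    using BB_eq_sum [of m "f * H (int s)"] by blast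
  obtain N2 where N2: "\<And>n. n \<ge> N2 \<Longrightarrow> BB m f = (\<Sum>i<n. ?t m f i)"
    using BB_eq_sum [of m f] by blast
  obtain N3 where N3: "\<And>n. n \<ge> N3 \<Longrightarrow> BB (m + 1) f = (\<Sum>i<n. ?t (m + 1) f i)"
    using BB_eq_sum [of "m + 1" f] by blast
  let ?n = "N1 + N2 + N3"
  \<comment> \<open>The range is one longer than \<open>?n\<close>, because the shift in the second
    sum discards the term \<open>i = 0\<close>.\<close>
  have "BB m (f * H (int s)) = (\<Sum>i<Suc ?n. ?t m (f * H (int s)) i)"
    by (rule N1) simp
  also have "\<dots> = (\<Sum>i<Suc ?n. ?t m f i * H (int s)) +
      (\<Sum>i<Suc ?n. (-1) ^ i * H (m + int i) *
        (if i = 0 then 0 else perp (F (ones (i - 1))) f) * H (int (s - 1)))"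
    unfolding perp_F_ones_mult_H [OF assms] sum.distrib [symmetric]
    by (rule sum.cong) (simp_all add: distrib_left mult.assoc)
  also have "(\<Sum>i<Suc ?n. ?t m f i * H (int s)) = BB m f * H (int s)"
    using N2 [of "Suc ?n"] by (simp add: sum_distrib_right distrib_right del: of_nat_Suc)
  also have "(\<Sum>i<Suc ?n. (-1) ^ i * H (m + int i) *
        (if i = 0 then 0 else perp (F (ones (i - 1))) f) * H (int (s - 1))) =
      (\<Sum>i<?n. - (?t (m + 1) f i * H (int (s - 1))))"
    by (subst sum.lessThan_Suc_shift) (simp add: add.assoc)
  also have "\<dots> = - (BB (m + 1) f * H (int (s - 1)))"
    using N3 [of ?n] by (simp add: sum_distrib_right sum_negf)
  finally show ?thesis by simp
qed

lemma H_zero [simp]: "H 0 = 1"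
  by (simp add: H_def)

text \<open>Solve \<open>BB_mult_H\<close> for \<open>BB m f * H (int s)\<close> and iterate: each
  round moves one unit from \<open>s\<close> to \<open>m\<close>. All signs have become
  positive.\<close>

lemma BB_times_H: "BB m f * H (int s) = (\<Sum>i\<le>s. BB (m + int i) (f * H (int (s - i))))"
proof (induction s arbitrary: m)
  case (Suc s)
  have "BB m f * H (int (Suc s)) = BB m (f * H (int (Suc s))) + BB (m + 1) f * H (int s)"
    using BB_mult_H [of "Suc s" m f] by simp
  also have "\<dots> = (\<Sum>i\<le>Suc s. BB (m + int i) (f * H (int (Suc s - i))))"
    unfolding Suc.IH
      sum.atMost_Suc_shift [of "\<lambda>i. BB (m + int i) (f * H (int (Suc s - i)))"]
    by (simp add: add.assoc)
  finally show ?case .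
qed simp

section \<open>Immaculate tableaux\<close>

lemma count_list_replicate: "count_list (replicate n x) y = (if x = y then n else 0)"
  by (induction n) auto

lemma count_list_eq_length_imp: "count_list xs x = length xs \<Longrightarrow> \<forall>y\<in>set xs. y = x"
proof (induction xs)
  case (Cons y xs)
  then show ?case
    using count_le_length [of xs x] by (auto split: if_splits)
qed simp

text \<open>The letters of a tableau are shifted here: its content \<open>bs\<close> lists the multiplicities of the letters
  \<open>k, k + 1, \<dots>\<close>, so that the smallest letter can be removed as well as the largest.\<close>

definition tableau :: "nat \<Rightarrow> nat list \<Rightarrow> nat list list \<Rightarrow> bool" where
  "tableau k bs T \<longleftrightarrow> [] \<notin> set T \<and>
     (\<forall>i. count_list (concat T) i = (if k \<le> i \<and> i < k + length bs then bs ! (i - k) else 0)) \<and>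
     (\<forall>row\<in>set T. sorted row) \<and> sorted_wrt (<) (map hd T)"

text \<open>Requiring the count for every \<open>i\<close> absorbs the exclusion of the letter 0,
  and positive parts force nonempty rows.\<close>

lemma immaculate_tableau_iff:
  "immaculate_tableau \<alpha> \<beta> T \<longleftrightarrow> map length T = parts \<alpha> \<and> tableau 1 (parts \<beta>) T"
proof -
  have 1: "[] \<notin> set T" if "map length T = parts \<alpha>"
    using that zero_notin_parts [of \<alpha>] by (metis image_eqI list.set_map list.size(3))
  have 2: "0 \<notin> set (concat T) \<and>
      (\<forall>i\<ge>1. count_list (concat T) i = (if i \<le> length (parts \<beta>) then parts \<beta> ! (i - 1) else 0)) \<longleftrightarrow>
      (\<forall>i. count_list (concat T) i =
        (if 1 \<le> i \<and> i < 1 + length (parts \<beta>) then parts \<beta> ! (i - 1) else 0))" (is "?L \<longleftrightarrow> ?R")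
  proof
    assume ?L
    then show ?R
      by (metis One_nat_def Suc_leI add.commute count_list_0_iff le_imp_less_Suc less_Suc_eq_le
          neq0_conv plus_1_eq_Suc)
  next
    assume R: ?R
    then have "count_list (concat T) 0 = 0" by simp
    then have "0 \<notin> set (concat T)" by (metis count_list_0_iff)
    moreover have "\<forall>i\<ge>1. count_list (concat T) i = (if i \<le> length (parts \<beta>) then parts \<beta> ! (i - 1) else 0)"
      using R by auto
    ultimately show ?L by blast
  qed
  show ?thesis
    unfolding immaculate_tableau_def tableau_def using 1 2 by blast
qed

lemma tableau_letters:
  assumes "tableau k bs T" "x \<in> set (concat T)"
  shows "k \<le> x \<and> x < k + length bs"
proof (rule ccontr)
  assume out: "\<not> ?thesis"
  have "count_list (concat T) x = (if k \<le> x \<and> x < k + length bs then bs ! (x - k) else 0)"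
    using assms(1) unfolding tableau_def by blast
  also have "\<dots> = 0"
    using out by (simp only: if_False)
  finally show False
    using assms(2) by (metis count_list_0_iff)
qed

text \<open>Both sides count the boxes, once by rows and once by letters.\<close>

lemma tableau_weight:
  assumes "tableau k bs T"
  shows "sum_list (map length T) = sum_list bs"
proof -
  have "set (concat T) \<subseteq> {k..<k + length bs}"
    using tableau_letters [OF assms] by (meson atLeastLessThan_iff subsetI)
  then have "sum_list (map length T) = sum (count_list (concat T)) {k..<k + length bs}"
    by (simp add: sum_count_set length_concat)
  also have "\<dots> = (\<Sum>i\<in>{k..<k + length bs}. bs ! (i - k))"
    by (rule sum.cong) (use assms in \<open>auto simp: tableau_def\<close>)
  also have "\<dots> = (\<Sum>i\<in>{0..<length bs}. bs ! i)"
    by (rule sum.reindex_bij_witness [of _ "\<lambda>i. i + k" "\<lambda>i. i - k"]) auto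
  finally show ?thesis
    by (simp add: sum_list_sum_nth)
qed

lemma tableau_Nil_iff: "tableau k [] T \<longleftrightarrow> T = []"
proof
  assume T: "tableau k [] T"
  have "set (concat T) = {}"
  proof (rule equals0I)
    fix x assume "x \<in> set (concat T)"
    from tableau_letters [OF T this] show False
      by auto
  qed
  moreover have "[] \<notin> set T"
    using T by (simp add: tableau_def)
  ultimately show "T = []"
    by (cases T) auto
qed (simp add: tableau_def)

text \<open>The recursion follows \<open>BB_times_H\<close>, with \<open>i\<close> the amount given
  to the first row. What is left after the last row opens a new bottom row, as \<open>BB_one\<close>
  prescribes, and for \<open>s = 0\<close> none, as \<open>H 0 = 1\<close>.\<close>

primrec extend :: "nat \<Rightarrow> nat list list \<Rightarrow> nat \<Rightarrow> nat list list set" where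
  "extend k [] s = {if s = 0 then [] else [replicate s k]}"
| "extend k (r # T) s = (\<Union>i\<le>s. (#) (r @ replicate i k) ` extend k T (s - i))"

text \<open>Indexing by lists lets row lengths serve as the index without first being shown
  positive.\<close>

definition immaculate_word :: "nat list \<Rightarrow> nsym" where
  "immaculate_word xs = foldr (\<lambda>a. BB (int a)) xs 1"

lemma finite_extend: "finite (extend k T s)"
  by (induction T arbitrary: s) auto

text \<open>The right Pieri rule, by applying \<open>BB_times_H\<close> row by row. Only row lengths
  enter, so \<open>k\<close> is arbitrary.\<close>

lemma immaculate_word_times_H:
  "immaculate_word (map length T) * H (int s) =
    (\<Sum>T'\<in>extend k T s. immaculate_word (map length T'))"
proof (induction T arbitrary: s)
  case Nil
  show ?case by (simp add: immaculate_word_def BB_one)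
next
  case (Cons r T)
  let ?I = "\<lambda>T. immaculate_word (map length T)"
  have "?I (r # T) * H (int s) = (\<Sum>i\<le>s. BB (int (length r + i)) (?I T * H (int (s - i))))"
    by (simp add: immaculate_word_def BB_times_H)
  also have "\<dots> = (\<Sum>i\<le>s. \<Sum>T'\<in>extend k T (s - i). ?I ((r @ replicate i k) # T'))"
    unfolding Cons.IH BB_sum by (simp add: immaculate_word_def)
  also have "\<dots> = (\<Sum>i\<le>s. \<Sum>T'\<in>(#) (r @ replicate i k) ` extend k T (s - i). ?I T')"
    by (simp add: sum.reindex)
  \<comment> \<open>The length of the first row reveals \<open>i\<close>, so the union is
    disjoint.\<close>
  also have "\<dots> = (\<Sum>T'\<in>extend k (r # T) s. ?I T')"
    unfolding extend.simps
    by (rule sum.UNION_disjoint [symmetric]) (auto simp: finite_extend)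
  finally show ?case .
qed

text \<open>Meant to undo \<open>extend k\<close>; discarding emptied rows removes a bottom row made
  only of \<open>k\<close>.\<close>

definition restrict_rows :: "nat \<Rightarrow> nat list list \<Rightarrow> nat list list" where
  "restrict_rows k T = filter ((\<noteq>) []) (map (filter (\<lambda>x. x < k)) T)"

text \<open>Since \<open>T\<close> is recovered from each of its extensions, different tableaux have
  disjoint sets of extensions.\<close>

lemma restrict_rows_extend:
  assumes "T' \<in> extend k T s" "[] \<notin> set T" "\<forall>x\<in>set (concat T). x < k"
  shows "restrict_rows k T' = T"
  using assms
proof (induction T arbitrary: T' s)
  case Nil
  then show ?case by (simp add: restrict_rows_def)
next
  case (Cons r T)
  then obtain i T'' where T': "T' = (r @ replicate i k) # T''" "T'' \<in> extend k T (s - i)"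
    by auto
  then have "restrict_rows k T'' = T"
    using Cons by auto
  moreover have "filter (\<lambda>x. x < k) (r @ replicate i k) = r"
    using Cons.prems(3) by simp
  ultimately show ?case
    using Cons.prems(2) T'(1) by (simp add: restrict_rows_def)
qed

text \<open>The copies of \<open>k\<close> follow smaller letters, so rows stay sorted and the heads
  of the nonempty old rows survive. The only possible new head is \<open>k\<close>, at the
  bottom.\<close>

lemma extend_properties:
  assumes "T' \<in> extend k T s" "[] \<notin> set T" "\<forall>x\<in>set (concat T). x < k" "\<forall>row\<in>set T. sorted row"
  shows "[] \<notin> set T'"
    and "count_list (concat T') i = count_list (concat T) i + (if i = k then s else 0)"
    and "\<forall>row\<in>set T'. sorted row"
    and "map hd T' = map hd T \<or> map hd T' = map hd T @ [k]"
  using assms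
proof (induction T arbitrary: T' s)
  case Nil
  {
    case 1 then show ?case by (simp split: if_splits)
  next
    case 2 then show ?case by (auto simp: count_list_replicate split: if_splits)
  next
    case 3 then show ?case by (simp split: if_splits)
  next
    case 4 then show ?case by (auto split: if_splits)
  }
next
  case (Cons r T)
  have *: "[] \<notin> set T' \<and>
      count_list (concat T') i = count_list (concat (r # T)) i + (if i = k then s else 0) \<and>
      (\<forall>row\<in>set T'. sorted row) \<and>
      (map hd T' = map hd (r # T) \<or> map hd T' = map hd (r # T) @ [k])"
    if p: "T' \<in> extend k (r # T) s" "[] \<notin> set (r # T)" "\<forall>x\<in>set (concat (r # T)). x < k"
      "\<forall>row\<in>set (r # T). sorted row" for T' s
  proof -
    obtain j T'' where T': "T' = (r @ replicate j k) # T''" "T'' \<in> extend k T (s - j)" "j \<le> s"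
      using p(1) by auto
    have q: "[] \<notin> set T" "\<forall>x\<in>set (concat T). x < k" "\<forall>row\<in>set T. sorted row"
      using p by auto
    have "sorted (r @ replicate j k)"
      using p(3,4) by (auto simp: sorted_append less_imp_le)
    then show ?thesis
      using p T' Cons.IH(1-4) [OF T'(2) q]
      by (auto simp: count_list_replicate)
  qed
  {
    case 1 then show ?case using * by blast
  next
    case 2 then show ?case using * by blast
  next
    case 3 then show ?case using * by blast
  next
    case 4 then show ?case using * by blast
  }
qed

lemma sorted_split_top:
  "sorted r \<Longrightarrow> \<forall>x\<in>set r. x \<le> k \<Longrightarrow> r = filter (\<lambda>x. x < k) r @ replicate (count_list r k) (k :: nat)"
proof (induction r)
  case (Cons x r)
  show ?case
  proof (cases "x < k")
    case False
    then have "x = k" "\<forall>y\<in>set r. y = k"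
      using Cons.prems by (auto simp: le_antisym)
    then show ?thesis
      using Cons by (auto simp: filter_empty_conv)
  qed (use Cons in auto)
qed simp

text \<open>Since the first column increases strictly, only the last row can consist of the largest letter.\<close>

lemma extend_restrict_rows:
  assumes "[] \<notin> set T" "\<forall>x\<in>set (concat T). x \<le> k" "\<forall>row\<in>set T. sorted row"
    "sorted_wrt (<) (map hd T)"
  shows "T \<in> extend k (restrict_rows k T) (count_list (concat T) k) \<and>
    map hd (restrict_rows k T) = filter (\<lambda>x. x < k) (map hd T)"
  using assms
proof (induction T)
  case (Cons r T)
  then have IH: "T \<in> extend k (restrict_rows k T) (count_list (concat T) k)"
      "map hd (restrict_rows k T) = filter (\<lambda>x. x < k) (map hd T)"
    by auto
  obtain x r' where r: "r = x # r'"
    using Cons.prems(1) by (cases r) auto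
  have split: "r = filter (\<lambda>x. x < k) r @ replicate (count_list r k) k"
    by (rule sorted_split_top) (use Cons.prems in auto)
  show ?case
  proof (cases "x < k")
    case True
    have "restrict_rows k (r # T) = filter (\<lambda>x. x < k) r # restrict_rows k T"
      using True r by (simp add: restrict_rows_def)
    moreover have "hd (filter (\<lambda>x. x < k) r) = hd r"
      using True r by simp
    moreover have "r # T \<in> extend k (filter (\<lambda>x. x < k) r # restrict_rows k T)
        (count_list (concat (r # T)) k)"
      unfolding extend.simps
      by (rule UN_I [of "count_list r k"]) (use IH(1) split in auto)
    ultimately show ?thesis
      using IH(2) True r by simp
  next
    case False
    have "T = []"
    proof (cases T)
      case (Cons r2 T2)
      then have "x < hd r2" "r2 \<noteq> []" "\<forall>y\<in>set r2. y \<le> k"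
        using Cons.prems r by auto
      then show ?thesis
        using False by (metis hd_in_set leD le_less_trans not_less order_less_le_trans)
    qed
    moreover have nil: "filter (\<lambda>x. x < k) r = []"
      using False Cons.prems(3) r by (auto simp: filter_empty_conv)
    moreover have eq: "replicate (count_list r k) k = r"
      using split nil by simp
    moreover have "count_list r k \<noteq> 0"
      using eq r by (metis list.distinct(1) replicate_0)
    ultimately show ?thesis
      using False r by (simp add: restrict_rows_def del: count_list.simps)
  qed
qed (simp add: restrict_rows_def)

lemma count_list_filter: "count_list (filter P xs) i = (if P i then count_list xs i else 0)"
  by (induction xs) auto

lemma concat_restrict_rows: "concat (restrict_rows k T) = filter (\<lambda>x. x < k) (concat T)"
  by (induction T) (auto simp: restrict_rows_def)

text \<open>The letter \<open>k + length bs\<close> is the largest one: \<open>restrict_rows\<close>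
  takes it out of a tableau and \<open>extend\<close> puts it back in every admissible way.\<close>

lemma tableau_snoc:
  assumes "s > 0"
  shows "{T. tableau k (bs @ [s]) T} = (\<Union>T\<in>{T. tableau k bs T}. extend (k + length bs) T s)"
    (is "?L = ?R")
proof
  let ?k = "k + length bs"
  show "?L \<subseteq> ?R"
  proof
    fix T assume "T \<in> ?L"
    then have T: "tableau k (bs @ [s]) T" by simp
    have "\<forall>x\<in>set (concat T). x \<le> ?k"
    proof
      fix x assume "x \<in> set (concat T)"
      from tableau_letters [OF T this] show "x \<le> ?k"
        by auto
    qed
    then have e: "T \<in> extend ?k (restrict_rows ?k T) (count_list (concat T) ?k)"
        "map hd (restrict_rows ?k T) = filter (\<lambda>x. x < ?k) (map hd T)"
      using extend_restrict_rows [of T ?k] T unfolding tableau_def by blast+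
    have "count_list (concat T) ?k = s"
      using T by (simp add: tableau_def)
    moreover have "tableau k bs (restrict_rows ?k T)"
      unfolding tableau_def e(2) concat_restrict_rows count_list_filter
      using T by (auto simp: tableau_def restrict_rows_def sorted_wrt_filter nth_append)
    ultimately show "T \<in> ?R"
      using e(1) by auto
  qed
  show "?R \<subseteq> ?L"
  proof
    fix T' assume "T' \<in> ?R"
    then obtain T where T: "tableau k bs T" "T' \<in> extend ?k T s" by blast
    have lt: "\<forall>x\<in>set (concat T). x < ?k"
      using tableau_letters [OF T(1)] by blast
    have T1: "[] \<notin> set T" "\<forall>row\<in>set T. sorted row"
      using T(1) by (auto simp: tableau_def)
    note p = extend_properties [OF T(2) T1(1) lt T1(2)]
    have "\<forall>x\<in>set (map hd T). x < ?k"
      using lt T1(1) by auto (metis hd_in_set)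
    moreover have "sorted_wrt (<) (map hd T)"
      using T(1) by (simp add: tableau_def)
    ultimately have "sorted_wrt (<) (map hd T')"
      using p(4) by (auto simp: sorted_wrt_append simp del: set_map)
    moreover have "count_list (concat T') i =
        (if k \<le> i \<and> i < k + length (bs @ [s]) then (bs @ [s]) ! (i - k) else 0)" for i
      using T(1) p(2) [of i] by (auto simp: tableau_def nth_append)
    ultimately show "T' \<in> ?L"
      using p(1,3) by (simp add: tableau_def)
  qed
qed

section \<open>Expansion of words in immaculate functions\<close>

lemma finite_tableau: "0 \<notin> set bs \<Longrightarrow> finite {T. tableau k bs T}"
proof (induction bs rule: rev_induct)
  case Nil
  have "{T. tableau k [] T} = {[]}"
    by (auto simp: tableau_Nil_iff)
  then show ?case by simp
qed (simp add: tableau_snoc finite_extend)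

text \<open>Each further factor of the word adds the next letter by the Pieri rule. Every tableau
  arises exactly once, because its predecessor is obtained by \<open>restrict_rows\<close>.\<close>

lemma HH_eq_sum_tableaux:
  "0 \<notin> set bs \<Longrightarrow> HH (Comp bs) = (\<Sum>T | tableau k bs T. immaculate_word (map length T))"
proof (induction bs rule: rev_induct)
  case Nil
  then show ?case
    by (simp add: tableau_Nil_iff immaculate_word_def HH_def flip: zero_comp_def)
next
  case (snoc s bs)
  let ?I = "\<lambda>T. immaculate_word (map length T)"
  let ?k = "k + length bs"
  have "HH (Comp (bs @ [s])) = HH (Comp bs) * H (int s)"
    using snoc.prems Comp_append [of bs "[s]"] by (simp add: HH_add H_nat)
  also have "\<dots> = (\<Sum>T | tableau k bs T. \<Sum>T'\<in>extend ?k T s. ?I T')"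
    using snoc by (simp add: sum_distrib_right immaculate_word_times_H [where k = ?k])
  also have "\<dots> = (\<Sum>T'\<in>(\<Union>T\<in>{T. tableau k bs T}. extend ?k T s). ?I T')"
  proof (rule sum.UNION_disjoint [symmetric])
    have r: "restrict_rows ?k T' = T" if "tableau k bs T" "T' \<in> extend ?k T s" for T T'
    proof (rule restrict_rows_extend [OF that(2)])
      show "[] \<notin> set T"
        using that(1) by (simp add: tableau_def)
      show "\<forall>x\<in>set (concat T). x < ?k"
        using tableau_letters [OF that(1)] by blast
    qed
    show "\<forall>T\<in>{T. tableau k bs T}. \<forall>U\<in>{T. tableau k bs T}.
        T \<noteq> U \<longrightarrow> extend ?k T s \<inter> extend ?k U s = {}"
      using r by blast
  qed (use snoc.prems in \<open>auto simp: finite_tableau finite_extend\<close>)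
  also have "\<dots> = (\<Sum>T | tableau k (bs @ [s]) T. ?I T)"
    using snoc.prems by (simp add: tableau_snoc)
  finally show ?case .
qed

lemma immaculate_conv_word: "immaculate \<alpha> = immaculate_word (parts \<alpha>)"
  by (simp add: immaculate_def immaculate_word_def)

text \<open>Collects the tableaux by shape. In the paired form the left side is
  \<open>M_coeff f \<beta>\<close>, so this relates coefficients of \<open>f\<close> to its values
  on immaculate functions.\<close>

lemma pairing_HH_eq_sum_K:
  "pairing (HH \<beta>) f = (\<Sum>\<alpha> | weight \<alpha> = weight \<beta>. of_nat (K \<alpha> \<beta>) * pairing (immaculate \<alpha>) f)"
proof -
  let ?T = "{T. tableau 1 (parts \<beta>) T}"
  let ?shape = "\<lambda>T. Comp (map length T)"
  have sh: "parts (?shape T) = map length T" if "T \<in> ?T" for T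
  proof -
    have "0 \<notin> set (map length T)"
      using that by (auto simp: tableau_def)
    then show ?thesis by (simp add: Comp_inverse)
  qed
  have wt: "weight (?shape T) = weight \<beta>" if "T \<in> ?T" for T
    using sh [OF that] tableau_weight [of 1 "parts \<beta>" T] that by (simp add: weight_def)
  have "pairing (HH \<beta>) f = (\<Sum>T\<in>?T. pairing (immaculate (?shape T)) f)"
    using HH_eq_sum_tableaux [of "parts \<beta>" 1]
    by (simp add: parts_inverse pairing_sum_left immaculate_conv_word sh)
  also have "\<dots> = (\<Sum>\<alpha> | weight \<alpha> = weight \<beta>. \<Sum>T | T \<in> ?T \<and> ?shape T = \<alpha>.
      pairing (immaculate (?shape T)) f)"
    by (rule sum.group [symmetric]) (use wt in \<open>auto simp: finite_tableau finite_weight_eq\<close>)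
  also have "\<dots> = (\<Sum>\<alpha> | weight \<alpha> = weight \<beta>. of_nat (K \<alpha> \<beta>) * pairing (immaculate \<alpha>) f)"
  proof (rule sum.cong [OF refl])
    fix \<alpha>
    have "{T. T \<in> ?T \<and> ?shape T = \<alpha>} = {T. immaculate_tableau \<alpha> \<beta> T}"
      using sh by (auto simp: immaculate_tableau_iff parts_inverse)
    moreover have "(\<Sum>T | T \<in> ?T \<and> ?shape T = \<alpha>. pairing (immaculate (?shape T)) f) =
        (\<Sum>T | T \<in> ?T \<and> ?shape T = \<alpha>. pairing (immaculate \<alpha>) f)"
      by (rule sum.cong) auto
    ultimately show "(\<Sum>T | T \<in> ?T \<and> ?shape T = \<alpha>. pairing (immaculate (?shape T)) f) =
        of_nat (K \<alpha> \<beta>) * pairing (immaculate \<alpha>) f"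
      by (simp add: K_def)
  qed
  finally show ?thesis .
qed

section \<open>Unitriangularity\<close>

text \<open>For positive entries this turns out to be the only tableau whose shape equals its
  content.\<close>

primrec superstandard :: "nat \<Rightarrow> nat list \<Rightarrow> nat list list" where
  "superstandard k [] = []"
| "superstandard k (b # bs) = replicate b k # superstandard (Suc k) bs"

lemma map_length_superstandard: "map length (superstandard k bs) = bs"
  by (induction bs arbitrary: k) auto

text \<open>Removing a row of smallest letters shifts the alphabet to \<open>Suc k\<close>.
  Conversely, all letters below that row exceed \<open>k\<close>, so the first column stays
  strict.\<close>

lemma tableau_Cons:
  assumes "b > 0"
  shows "tableau k (b # bs) (replicate b k # T) \<longleftrightarrow> tableau (Suc k) bs T"
proof -
  have c: "(\<forall>i. count_list (concat (replicate b k # T)) i =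
        (if k \<le> i \<and> i < k + length (b # bs) then (b # bs) ! (i - k) else 0)) \<longleftrightarrow>
      (\<forall>i. count_list (concat T) i =
        (if Suc k \<le> i \<and> i < Suc k + length bs then bs ! (i - Suc k) else 0))"
  proof (rule all_cong1)
    fix i
    show "count_list (concat (replicate b k # T)) i =
        (if k \<le> i \<and> i < k + length (b # bs) then (b # bs) ! (i - k) else 0) \<longleftrightarrow>
      count_list (concat T) i =
        (if Suc k \<le> i \<and> i < Suc k + length bs then bs ! (i - Suc k) else 0)"
      by (cases "i = k") (auto simp: count_list_replicate nth_Cons')
  qed
  have "k < hd r" if "tableau (Suc k) bs T" "r \<in> set T" for r
  proof -
    have "r \<noteq> []"
      using that by (auto simp: tableau_def)
    then have "hd r \<in> set (concat T)"
      using that(2) by (auto intro!: bexI [of _ r])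
    from tableau_letters [OF that(1) this] show ?thesis
      by auto
  qed
  then show ?thesis
    using assms c by (auto simp: tableau_def)
qed

lemma tableau_superstandard: "0 \<notin> set bs \<Longrightarrow> tableau k bs (superstandard k bs)"
  by (induction bs arbitrary: k) (simp_all add: tableau_Nil_iff tableau_Cons)

text \<open>The smallest letter occurs in the first row only, and fills it if the first part of the shape
  equals the first part of the content.\<close>

lemma tableau_lex:
  assumes "tableau k bs T" "0 \<notin> set bs"
  shows "bs < map length T \<or> T = superstandard k bs"
  using assms
proof (induction bs arbitrary: k T)
  case Nil
  then show ?case by (simp add: tableau_Nil_iff)
next
  case (Cons b bs)
  have b: "b > 0" using Cons.prems by auto
  have ck: "count_list (concat T) k = b"
    using Cons.prems(1) by (simp add: tableau_def)
  then obtain r T' where T: "T = r # T'"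
    using b by (cases T) auto
  \<comment> \<open>A row containing \<open>k\<close> has head at most \<open>k\<close>, yet below
    the first row its head must exceed \<open>hd r\<close>, which is at least
    \<open>k\<close>.\<close>
  have "k \<notin> set (concat T')"
  proof
    assume "k \<in> set (concat T')"
    then obtain r' where r': "r' \<in> set T'" "k \<in> set r'" by auto
    have "hd r < hd r'" "sorted r'" "r \<noteq> []"
      using Cons.prems(1) r' T by (auto simp: tableau_def)
    moreover have "hd r' \<le> k"
      using r'(2) \<open>sorted r'\<close> by (cases r') auto
    moreover have "k \<le> hd r"
      using tableau_letters [OF Cons.prems(1), of "hd r"] T \<open>r \<noteq> []\<close> by simp
    ultimately show False by simp
  qed
  then have cr: "count_list r k = b"
    using ck T by (simp add: count_list_0_iff)
  show ?case
  \<comment> \<open>A longer first row decides the lexicographic comparison at once. Otherwise the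
    \<open>b\<close> copies of \<open>k\<close> fill the row and the remaining rows are
    compared.\<close>
  proof (cases "b < length r")
    case True
    then show ?thesis using T by simp
  next
    case False
    then have len: "length r = b"
      using cr count_le_length [of r k] by simp
    have "r = replicate b k"
    proof -
      have "\<forall>x\<in>set r. x = k"
        using count_list_eq_length_imp [of r k] cr len by simp
      then show ?thesis
        using len by (metis replicate_length_same)
    qed
    then show ?thesis
      using Cons.IH [of "Suc k" T'] Cons.prems T b by (auto simp: tableau_Cons)
  qed
qed

lemma K_nonzero_less:
  assumes "K \<alpha> \<beta> \<noteq> 0" "\<alpha> \<noteq> \<beta>"
  shows "parts \<beta> < parts \<alpha>"
proof -
  obtain T where "immaculate_tableau \<alpha> \<beta> T"
    using assms(1) unfolding K_def by (metis card.empty empty_Collect_eq)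
  then have T: "map length T = parts \<alpha>" "tableau 1 (parts \<beta>) T"
    by (simp_all add: immaculate_tableau_iff)
  show ?thesis
    using tableau_lex [OF T(2)] T(1) assms(2) map_length_superstandard [of 1 "parts \<beta>"]
    by (auto simp: parts_inject)
qed

lemma K_self: "K \<alpha> \<alpha> = 1"
proof -
  have "T = superstandard 1 (parts \<alpha>)" if "immaculate_tableau \<alpha> \<alpha> T" for T
    using tableau_lex [of 1 "parts \<alpha>" T] that by (auto simp: immaculate_tableau_iff)
  moreover have "immaculate_tableau \<alpha> \<alpha> (superstandard 1 (parts \<alpha>))"
    by (simp add: immaculate_tableau_iff map_length_superstandard tableau_superstandard)
  ultimately have "{T. immaculate_tableau \<alpha> \<alpha> T} = {superstandard 1 (parts \<alpha>)}"
    by blast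
  then show ?thesis by (simp add: K_def)
qed

section \<open>The dual basis\<close>

lemma M_coeff_QSym_deg: "f \<in> QSym_deg n \<Longrightarrow> weight \<beta> \<noteq> n \<Longrightarrow> M_coeff f \<beta> = 0"
  using M_coeff_nonzero_mdeg [of f \<beta>] by (auto simp: QSym_deg_def)

lemma QSym_deg_eqI:
  assumes "f \<in> QSym_deg n" "g \<in> QSym_deg n"
    and "\<And>\<beta>. weight \<beta> = n \<Longrightarrow> M_coeff f \<beta> = M_coeff g \<beta>"
  shows "f = g"
proof -
  have "M_coeff f = M_coeff g"
    using assms by (metis M_coeff_QSym_deg ext)
  then show ?thesis
    using QSym_expansion [of f n] QSym_expansion [of g n] assms(1,2)
    by (auto simp: QSym_deg_def)
qed

lemma M_combination_in_QSym_deg: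
  assumes "\<And>\<beta>. \<beta> \<in> A \<Longrightarrow> weight \<beta> = n"
  shows "(\<lambda>m. \<Sum>\<beta>\<in>A. c \<beta> * M \<beta> m) \<in> QSym_deg n"
proof -
  have deg: "mdeg m = n" if nz: "(\<Sum>\<beta>\<in>A. c \<beta> * M \<beta> m) \<noteq> 0" for m
  proof -
    obtain \<beta> where "\<beta> \<in> A" "c \<beta> * M \<beta> m \<noteq> 0"
      using nz by (meson sum.not_neutral_contains_not_neutral)
    then show ?thesis
      using assms M_in_QSym_deg [of \<beta>] by (auto simp: QSym_deg_def)
  qed
  then show ?thesis
    by (auto simp: QSym_deg_def QSym_def M_mono_word)
qed

text \<open>Downward induction in the lexicographic order inverts the unitriangular matrix \<open>K\<close>.\<close>

lemma pairing_immaculate_eq_delta: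
  assumes "\<And>\<beta>. weight \<beta> = n \<Longrightarrow> M_coeff f \<beta> = of_nat (K \<alpha> \<beta>)" and "weight \<alpha> = n" "weight \<beta> = n"
  shows "pairing (immaculate \<beta>) f = (if \<beta> = \<alpha> then 1 else 0)"
  using assms(3)
\<comment> \<open>The measure is the number of compositions of \<open>n\<close> above \<beta>, so
  the lexicographically largest one comes first.\<close>
proof (induction "card {\<gamma>. weight \<gamma> = n \<and> parts \<beta> < parts \<gamma>}" arbitrary: \<beta> rule: less_induct)
  case less
  let ?W = "{\<gamma>. weight \<gamma> = n}"
  have IH: "pairing (immaculate \<gamma>) f = (if \<gamma> = \<alpha> then 1 else 0)"
    if "weight \<gamma> = n" "parts \<beta> < parts \<gamma>" for \<gamma>
  proof (rule less.hyps)
    show "card {\<delta>. weight \<delta> = n \<and> parts \<gamma> < parts \<delta>} < card {\<delta>. weight \<delta> = n \<and> parts \<beta> < parts \<delta>}"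
    proof (rule psubset_card_mono)
      show "finite {\<delta>. weight \<delta> = n \<and> parts \<beta> < parts \<delta>}"
        by (rule finite_subset [OF _ finite_weight_eq [of n]]) auto
      show "{\<delta>. weight \<delta> = n \<and> parts \<gamma> < parts \<delta>} \<subset> {\<delta>. weight \<delta> = n \<and> parts \<beta> < parts \<delta>}"
        using that by (auto dest: less_trans)
    qed
  qed (use that in simp)
  have "of_nat (K \<alpha> \<beta>) = (\<Sum>\<gamma>\<in>?W. of_nat (K \<gamma> \<beta>) * pairing (immaculate \<gamma>) f)"
    using pairing_HH_eq_sum_K [of \<beta> f] assms(1) less.prems by (simp add: pairing_HH)
  also have "\<dots> = pairing (immaculate \<beta>) f +
      (\<Sum>\<gamma>\<in>?W - {\<beta>}. of_nat (K \<gamma> \<beta>) * pairing (immaculate \<gamma>) f)"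
    using less.prems by (subst sum.remove [of _ \<beta>]) (simp_all add: finite_weight_eq K_self)
  \<comment> \<open>Off the diagonal, a nonzero \<open>K \<gamma> \<beta>\<close> puts \<gamma>
    above \<beta>, where the induction hypothesis applies.\<close>
  also have "(\<Sum>\<gamma>\<in>?W - {\<beta>}. of_nat (K \<gamma> \<beta>) * pairing (immaculate \<gamma>) f) =
      (\<Sum>\<gamma>\<in>?W - {\<beta>}. if \<gamma> = \<alpha> then of_nat (K \<alpha> \<beta>) else 0)"
  proof (rule sum.cong [OF refl])
    fix \<gamma> assume "\<gamma> \<in> ?W - {\<beta>}"
    then show "of_nat (K \<gamma> \<beta>) * pairing (immaculate \<gamma>) f = (if \<gamma> = \<alpha> then of_nat (K \<alpha> \<beta>) else 0)"
      using IH [of \<gamma>] K_nonzero_less [of \<gamma> \<beta>] by (cases "K \<gamma> \<beta> = 0") auto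
  qed
  also have "\<dots> = (if \<beta> = \<alpha> then 0 else of_nat (K \<alpha> \<beta>))"
    using assms(2) by (auto simp: finite_weight_eq)
  \<comment> \<open>For \<beta> = \<alpha> the equation reads 1 = pairing + 0; otherwise
    \<open>K \<alpha> \<beta>\<close> stands on both sides and cancels.\<close>
  finally show ?case
    by (auto simp: K_self split: if_splits)
qed

theorem theorem3p21:
  fixes \<alpha> :: comp
  shows "dual_immaculate \<alpha> =
           (\<lambda>m. \<Sum>\<beta> | weight \<beta> = weight \<alpha> \<and> parts \<beta> \<le> parts \<alpha>. of_nat (K \<alpha> \<beta>) * M \<beta> m) \<and>
         monomial_positive (dual_immaculate \<alpha>)"
proof -
  let ?n = "weight \<alpha>"
  let ?A = "{\<beta>. weight \<beta> = ?n \<and> parts \<beta> \<le> parts \<alpha>}"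
  define f :: series where "f = (\<lambda>m. \<Sum>\<beta>\<in>?A. of_nat (K \<alpha> \<beta>) * M \<beta> m)"
  have fin: "finite ?A"
    by (rule finite_subset [OF _ finite_weight_eq [of ?n]]) auto
  have f_deg: "f \<in> QSym_deg ?n"
    unfolding f_def by (rule M_combination_in_QSym_deg) simp
  have M_coeff_f: "M_coeff f \<beta> = (if \<beta> \<in> ?A then of_nat (K \<alpha> \<beta>) else 0)" for \<beta>
    unfolding f_def M_coeff_sum M_coeff_M
    using fin by (simp add: if_distrib [of "(*) _"] cong: if_cong)
  \<comment> \<open>The lexicographic restriction loses nothing, since
    \<open>K \<alpha> \<beta>\<close> vanishes unless \<beta> is at most \<alpha>.\<close>
  have coeff: "M_coeff f \<beta> = of_nat (K \<alpha> \<beta>)" if "weight \<beta> = ?n" for \<beta>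
  proof (cases "K \<alpha> \<beta> = 0")
    case False
    then have "parts \<beta> \<le> parts \<alpha>"
      using K_nonzero_less [of \<alpha> \<beta>] by (cases "\<alpha> = \<beta>") (simp_all add: less_imp_le)
    with that show ?thesis by (simp add: M_coeff_f)
  qed (simp add: M_coeff_f)
  have "dual_immaculate \<alpha> = f"
    unfolding dual_immaculate_def
  proof (rule the_equality)
    show "f \<in> QSym_deg ?n \<and>
        (\<forall>\<beta>. weight \<beta> = ?n \<longrightarrow> pairing (immaculate \<beta>) f = (if \<beta> = \<alpha> then 1 else 0))"
      using f_deg pairing_immaculate_eq_delta [OF coeff refl] by blast
  next
    fix g
    assume g: "g \<in> QSym_deg ?n \<and>
        (\<forall>\<beta>. weight \<beta> = ?n \<longrightarrow> pairing (immaculate \<beta>) g = (if \<beta> = \<alpha> then 1 else 0))"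
    show "g = f"
    proof (rule QSym_deg_eqI [of _ ?n])
      fix \<beta> assume w: "weight \<beta> = ?n"
      \<comment> \<open>Uniqueness: the words are combinations of immaculate functions, so the
        pairings with these determine every coefficient of \<open>g\<close>.\<close>
      have "M_coeff g \<beta> = (\<Sum>\<gamma> | weight \<gamma> = ?n. if \<gamma> = \<alpha> then of_nat (K \<gamma> \<beta>) else 0)"
        unfolding pairing_HH [symmetric] pairing_HH_eq_sum_K w
        by (rule sum.cong) (use g in auto)
      then show "M_coeff g \<beta> = M_coeff f \<beta>"
        using coeff [OF w] by (simp add: finite_weight_eq)
    qed (use g f_deg in auto)
  qed
  moreover have "monomial_positive f"
    using f_deg by (simp add: monomial_positive_def QSym_deg_def M_coeff_f)
  ultimately show ?thesis
    by (simp add: f_def)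
qed

end
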